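(* There are numerical (absolute) constants $C_4,C_5>0$ such that the following holds. Let $A,B\subset\mathbb Z^2$ be nonempty finite sets, $S=A+B$, and let $x_k=\sum_{j=1}^s\widetilde c_j z_{1,j}^{k_1}z_{2,j}^{k_2}$ ($k\in S$) be the exponential-sum data with nonzero amplitudes and location set $\mathcal T=\{\boldsymbol t_1,\dots,\boldsymbol t_s\}$ contained in the interior of the field of view $\mathcal F$. Suppose that $\mu_1$ is defined (i.e. $V_A$ and $V_B$ have full column rank), that the locations are $\Delta$-separated, and that for some $c_{\rm M}>0$ $$\mathcal R(\boldsymbol t)\ge c_{\rm M}\min\{\Delta/4,\ d_{\rm per}(\boldsymbol t,\mathcal T)\}\qquad\text{for all }\boldsymbol t\in\mathcal F.\tag{$*$}$$ Then, for every sufficiently small admissible choice of $c_{\rm M}$ (that is, there is $c_0>0$ depending on the configuration $A,B,\mathcal F,\mathcal T,\Delta,\Delta q_1,\Delta q_2$ such that for every $c_{\rm M}\in(0,c_0]$ satisfying $( * )$), the following is true: if $\widehat{\boldsymbol x}\in\mathbb C^S$ satisfies $$\Delta\ge C_4\,\frac{\mu_1\,\|\mathcal H_{A,B}(\widehat{\boldsymbol x}-\boldsymbol x)\|_2}{c_{\rm M}\sqrt{|A||B|}\,\min_j|\widetilde c_j|},$$ then the $s$ smallest local minima $\widehat{\boldsymbol t}_1,\dots,\widehat{\boldsymbol t}_s$ over $\mathcal F$ of the two-sided MUSIC residual $\widehat{\mathcal R}$ formed from $\widehat{\boldsymbol x}$ (exact continuous selection) can be labeled so that $$\max_j d_{\rm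 per}(\widehat{\boldsymbol t}_j,\boldsymbol t_j)\le C_5\,\frac{\mu_1\,\|\mathcal H_{A,B}(\widehat{\boldsymbol x}-\boldsymbol x)\|_2}{c_{\rm M}\sqrt{|A||B|}\,\min_j|\widetilde c_j|}.$$
   Context: Data. Fix spacings $\Delta q_1,\Delta q_2>0$. For $s\ge1$ distinct locations $\boldsymbol t_j=(t_{1,j},t_{2,j})^T\in\mathbb R^2$ put $z_{\ell,j}=e^{-\mathrm i\Delta q_\ell t_{\ell,j}}$; $\widetilde c_j\in\mathbb C\setminus\{0\}$. For $\boldsymbol u\in\mathbb C^S$, $[\mathcal H_{A,B}(\boldsymbol u)]_{\alpha,\beta}=u_{\alpha+\beta}$, $\alpha\in A,\beta\in B$. For $C\in\{A,B\}$, $[V_C]_{\alpha,j}=z_{1,j}^{\alpha_1}z_{2,j}^{\alpha_2}$ ($|C|\times s$). If both have full column rank, $\mu_1=\max\{|A|/\lambda_{\min}(V_A^*V_A),\,|B|/\lambda_{\min}(V_B^*V_B)\}$. $\|\cdot\|_2$ is the spectral norm (Euclidean norm for vectors). Field of view and separation. $\mathcal F\subset\mathbb R^2$ is a compact axis-parallel rectangle whose side lengths are smaller than the periods $2\pi/\Delta q_1$ and $2\pi/\Delta q_2$, respectively. The periodic distance is $$d_{\rm per}(\boldsymbol t,\boldsymbol t')=\Big[\min_{m\in\mathbb Z}|t_1-t_1'-2\pi m/\Delta q_1|^2+\min_{m\in\mathbb Z}|t_2-t_2'-2\pi m/\Delta q_2|^2\Big]^{1/2},$$ and $d_{\rm per}(\boldsymbol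 t,\mathcal T)=\min_j d_{\rm per}(\boldsymbol t,\boldsymbol t_j)$. For $\Delta>0$, a set is $\Delta$-separated if all pairwise periodic distances of distinct points are at least $\Delta$ (for $s=1$, $\Delta>0$ is just a prescribed scale). MUSIC residuals. For $C\in\{A,B\}$ let $[\boldsymbol v_C(\boldsymbol t)]_\alpha=e^{-\mathrm i(\alpha_1\Delta q_1t_1+\alpha_2\Delta q_2t_2)}$, $\alpha\in C$. For projectors $P$ on $\mathbb C^{|A|}$ and $Q$ on $\mathbb C^{|B|}$ consider $$\Big[\frac{\|(I-P)\boldsymbol v_A(\boldsymbol t)\|_2^2}{|A|}+\frac{\|(I-Q)\overline{\boldsymbol v_B(\boldsymbol t)}\|_2^2}{|B|}\Big]^{1/2}.$$ The exact residual $\mathcal R(\boldsymbol t)$ is obtained with $P,Q$ the orthogonal projectors onto $\operatorname{range}(V_A)$ and $\operatorname{range}(\overline{V_B})$. The residual $\widehat{\mathcal R}(\boldsymbol t)$ is obtained with $P=\widehat U\widehat U^*$, $Q=\widehat V\widehat V^*$, where $\widehat U\widehat\Sigma\widehat V^*$ is the rank-$s$ truncated SVD of $\mathcal H_{A,B}(\widehat{\boldsymbol x})$. Local minima are understood relative to $\mathcal F$. Condition $( * )$ stays valid when $c_{\rm M}$ is decreased. *)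

theory Defs
  imports "HOL-Analysis.Analysis" "Jordan_Normal_Form.Char_Poly"
begin

text \<open>
  The index sets \<open>A\<close>, \<open>B\<close> vary inside the statement, so a vector in \<open>\<complex>\<^sup>I\<close> is a function
  on the index type of which only the values on \<open>I\<close> matter; an \<open>I \<times> J\<close> matrix is a binary
  function, likewise. Columns belonging to the \<open>s\<close> locations are indexed by \<open>{..<s}\<close>.
\<close>

definition vnorm :: "'i set \<Rightarrow> ('i \<Rightarrow> complex) \<Rightarrow> real" where
  "vnorm I v = L2_set (\<lambda>i. cmod (v i)) I"

definition vinner :: "'i set \<Rightarrow> ('i \<Rightarrow> complex) \<Rightarrow> ('i \<Rightarrow> complex) \<Rightarrow> complex" where
  "vinner I u v = (\<Sum>i\<in>I. cnj (u i) * v i)"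

definition mat_app :: "'j set \<Rightarrow> ('i \<Rightarrow> 'j \<Rightarrow> complex) \<Rightarrow> ('j \<Rightarrow> complex) \<Rightarrow> 'i \<Rightarrow> complex" where
  "mat_app J M v i = (\<Sum>j\<in>J. M i j * v j)"

definition spectral_norm :: "'i set \<Rightarrow> 'j set \<Rightarrow> ('i \<Rightarrow> 'j \<Rightarrow> complex) \<Rightarrow> real" where
  "spectral_norm I J M = (SUP v\<in>{v. vnorm J v \<le> 1}. vnorm I (mat_app J M v))"

definition full_column_rank :: "'i set \<Rightarrow> nat \<Rightarrow> ('i \<Rightarrow> nat \<Rightarrow> complex) \<Rightarrow> bool" where
  "full_column_rank I s V \<longleftrightarrow>
     (\<forall>c. (\<forall>i\<in>I. mat_app {..<s} V c i = 0) \<longrightarrow> (\<forall>j<s. c j = 0))"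

definition gram :: "'i set \<Rightarrow> nat \<Rightarrow> ('i \<Rightarrow> nat \<Rightarrow> complex) \<Rightarrow> complex Matrix.mat" where
  "gram I s V = Matrix.mat s s (\<lambda>(j, k). \<Sum>i\<in>I. cnj (V i j) * V i k)"

text \<open>For Hermitian matrices, whose eigenvalues are all real.\<close>

definition lambda_min :: "complex Matrix.mat \<Rightarrow> real" where
  "lambda_min G = Min {l. eigenvalue G (complex_of_real l)}"

definition column_space :: "'i set \<Rightarrow> nat \<Rightarrow> ('i \<Rightarrow> nat \<Rightarrow> complex) \<Rightarrow> ('i \<Rightarrow> complex) set" where
  "column_space I s V = {w. \<exists>c. \<forall>i\<in>I. w i = mat_app {..<s} V c i}"

definition is_orth_projector ::
  "'i set \<Rightarrow> ('i \<Rightarrow> complex) set \<Rightarrow> ('i \<Rightarrow> 'i \<Rightarrow> complex) \<Rightarrow> bool" where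
  "is_orth_projector I W P \<longleftrightarrow>
     (\<forall>v. mat_app I P v \<in> W \<and> (\<forall>w\<in>W. vinner I w (\<lambda>i. v i - mat_app I P v i) = 0))"

text \<open>The entries of the projector on \<open>I \<times> I\<close> are unique; the choice only concerns the
  irrelevant values outside of \<open>I \<times> I\<close>.\<close>

definition orth_projector :: "'i set \<Rightarrow> ('i \<Rightarrow> complex) set \<Rightarrow> 'i \<Rightarrow> 'i \<Rightarrow> complex" where
  "orth_projector I W = (SOME P. is_orth_projector I W P)"

text \<open>Singular value decomposition \<open>M = U \<Sigma> V\<^sup>*\<close> in thin form, with \<open>min |I| |J|\<close> singular
  values in decreasing order. Its rank-\<open>s\<close> truncation keeps the columns \<open>k < s\<close>.\<close>

definition is_svd :: "'i set \<Rightarrow> 'j set \<Rightarrow> ('i \<Rightarrow> 'j \<Rightarrow> complex) \<Rightarrow>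
    ('i \<Rightarrow> nat \<Rightarrow> complex) \<Rightarrow> (nat \<Rightarrow> real) \<Rightarrow> ('j \<Rightarrow> nat \<Rightarrow> complex) \<Rightarrow> bool" where
  "is_svd I J M U \<sigma> V \<longleftrightarrow>
     (let r = min (card I) (card J) in
        (\<forall>k<r. \<forall>l<r. vinner I (\<lambda>i. U i k) (\<lambda>i. U i l) = (if k = l then 1 else 0)) \<and>
        (\<forall>k<r. \<forall>l<r. vinner J (\<lambda>j. V j k) (\<lambda>j. V j l) = (if k = l then 1 else 0)) \<and>
        (\<forall>k<r. 0 \<le> \<sigma> k) \<and>
        (\<forall>k l. k \<le> l \<and> l < r \<longrightarrow> \<sigma> l \<le> \<sigma> k) \<and>
        (\<forall>i\<in>I. \<forall>j\<in>J. M i j = (\<Sum>k<r. U i k * complex_of_real (\<sigma> k) * cnj (V j k))))"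

definition leading_projector :: "nat \<Rightarrow> ('i \<Rightarrow> nat \<Rightarrow> complex) \<Rightarrow> 'i \<Rightarrow> 'i \<Rightarrow> complex" where
  "leading_projector s U i i' = (\<Sum>k<s. U i k * cnj (U i' k))"

text \<open>Throughout, \<open>q = (\<Delta>q\<^sub>1, \<Delta>q\<^sub>2)\<close> are the spacings.\<close>

definition node :: "real \<Rightarrow> real \<Rightarrow> complex" where
  "node d \<tau> = exp (- (\<i> * complex_of_real (d * \<tau>)))"

definition vander :: "real \<times> real \<Rightarrow> (nat \<Rightarrow> real \<times> real) \<Rightarrow> int \<times> int \<Rightarrow> nat \<Rightarrow> complex" where
  "vander q t \<alpha> j =
     node (fst q) (fst (t j)) powi fst \<alpha> * node (snd q) (snd (t j)) powi snd \<alpha>"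

definition exp_sum :: "real \<times> real \<Rightarrow> nat \<Rightarrow> (nat \<Rightarrow> real \<times> real) \<Rightarrow> (nat \<Rightarrow> complex) \<Rightarrow>
    int \<times> int \<Rightarrow> complex" where
  "exp_sum q s t c k =
     (\<Sum>j<s. c j * node (fst q) (fst (t j)) powi fst k * node (snd q) (snd (t j)) powi snd k)"

definition sumset :: "(int \<times> int) set \<Rightarrow> (int \<times> int) set \<Rightarrow> (int \<times> int) set" where
  "sumset A B = {\<alpha> + \<beta> | \<alpha> \<beta>. \<alpha> \<in> A \<and> \<beta> \<in> B}"

text \<open>As an \<open>A \<times> B\<close> matrix, this depends on \<open>u\<close> only through its values on \<open>sumset A B\<close>.\<close>

definition hankel :: "(int \<times> int \<Rightarrow> complex) \<Rightarrow> int \<times> int \<Rightarrow> int \<times> int \<Rightarrow> complex" where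
  "hankel u \<alpha> \<beta> = u (\<alpha> + \<beta>)"

definition mu1 :: "(int \<times> int) set \<Rightarrow> (int \<times> int) set \<Rightarrow> real \<times> real \<Rightarrow> nat \<Rightarrow>
    (nat \<Rightarrow> real \<times> real) \<Rightarrow> real" where
  "mu1 A B q s t = max (real (card A) / lambda_min (gram A s (vander q t)))
                       (real (card B) / lambda_min (gram B s (vander q t)))"

text \<open>The infima over the shifts \<open>m\<close> are attained.\<close>

definition d_per :: "real \<times> real \<Rightarrow> real \<times> real \<Rightarrow> real \<times> real \<Rightarrow> real" where
  "d_per q t t' = sqrt (
     (INF m::int. \<bar>fst t - fst t' - 2 * pi * of_int m / fst q\<bar>\<^sup>2) +
     (INF m::int. \<bar>snd t - snd t' - 2 * pi * of_int m / snd q\<bar>\<^sup>2))"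

definition d_per_set :: "real \<times> real \<Rightarrow> real \<times> real \<Rightarrow> (real \<times> real) set \<Rightarrow> real" where
  "d_per_set q p T = Min (d_per q p ` T)"

definition separated :: "real \<times> real \<Rightarrow> real \<Rightarrow> (real \<times> real) set \<Rightarrow> bool" where
  "separated q \<Delta> T \<longleftrightarrow> (\<forall>p\<in>T. \<forall>p'\<in>T. p \<noteq> p' \<longrightarrow> \<Delta> \<le> d_per q p p')"

definition steering :: "real \<times> real \<Rightarrow> real \<times> real \<Rightarrow> int \<times> int \<Rightarrow> complex" where
  "steering q p \<alpha> = exp (- (\<i> * complex_of_real
     (of_int (fst \<alpha>) * fst q * fst p + of_int (snd \<alpha>) * snd q * snd p)))"

definition residual :: "(int \<times> int) set \<Rightarrow> (int \<times> int) set \<Rightarrow> real \<times> real \<Rightarrow>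
    (int \<times> int \<Rightarrow> int \<times> int \<Rightarrow> complex) \<Rightarrow> (int \<times> int \<Rightarrow> int \<times> int \<Rightarrow> complex) \<Rightarrow>
    real \<times> real \<Rightarrow> real" where
  "residual A B q P Q p =
     (let v = steering q p; w = (\<lambda>\<beta>. cnj (steering q p \<beta>)) in
      sqrt ((vnorm A (\<lambda>\<alpha>. v \<alpha> - mat_app A P v \<alpha>))\<^sup>2 / real (card A) +
            (vnorm B (\<lambda>\<beta>. w \<beta> - mat_app B Q w \<beta>))\<^sup>2 / real (card B)))"

definition exact_residual :: "(int \<times> int) set \<Rightarrow> (int \<times> int) set \<Rightarrow> real \<times> real \<Rightarrow> nat \<Rightarrow>
    (nat \<Rightarrow> real \<times> real) \<Rightarrow> real \<times> real \<Rightarrow> real" where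
  "exact_residual A B q s t =
     residual A B q
       (orth_projector A (column_space A s (vander q t)))
       (orth_projector B (column_space B s (\<lambda>\<beta> j. cnj (vander q t \<beta> j))))"

definition svd_residual :: "(int \<times> int) set \<Rightarrow> (int \<times> int) set \<Rightarrow> real \<times> real \<Rightarrow> nat \<Rightarrow>
    (int \<times> int \<Rightarrow> nat \<Rightarrow> complex) \<Rightarrow> (int \<times> int \<Rightarrow> nat \<Rightarrow> complex) \<Rightarrow> real \<times> real \<Rightarrow> real" where
  "svd_residual A B q s U V = residual A B q (leading_projector s U) (leading_projector s V)"

definition residual_growth :: "(int \<times> int) set \<Rightarrow> (int \<times> int) set \<Rightarrow> real \<times> real \<Rightarrow> nat \<Rightarrow>
    (nat \<Rightarrow> real \<times> real) \<Rightarrow> (real \<times> real) set \<Rightarrow> real \<Rightarrow> real \<Rightarrow> bool" where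
  "residual_growth A B q s t F \<Delta> cM \<longleftrightarrow>
     (\<forall>p\<in>F. exact_residual A B q s t p \<ge> cM * min (\<Delta> / 4) (d_per_set q p (t ` {..<s})))"

definition local_min_on :: "('a::topological_space \<Rightarrow> real) \<Rightarrow> 'a set \<Rightarrow> 'a \<Rightarrow> bool" where
  "local_min_on f F p \<longleftrightarrow> p \<in> F \<and> (\<forall>\<^sub>F y in at p within F. f p \<le> f y)"

text \<open>\<open>M\<close> is a choice of \<open>s\<close> distinct local minimizers of \<open>f\<close> relative to \<open>F\<close> with the \<open>s\<close>
  smallest values of \<open>f\<close> among all of them; with ties there could be several such choices.\<close>

definition smallest_local_minima ::
  "('a::topological_space \<Rightarrow> real) \<Rightarrow> 'a set \<Rightarrow> nat \<Rightarrow> 'a set \<Rightarrow> bool" where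
  "smallest_local_minima f F s M \<longleftrightarrow>
     finite M \<and> card M = s \<and> (\<forall>p\<in>M. local_min_on f F p) \<and>
     (\<forall>p\<in>M. \<forall>p'. local_min_on f F p' \<and> p' \<notin> M \<longrightarrow> f p \<le> f p')"

definition error_scale :: "(int \<times> int) set \<Rightarrow> (int \<times> int) set \<Rightarrow> real \<times> real \<Rightarrow> nat \<Rightarrow>
    (nat \<Rightarrow> real \<times> real) \<Rightarrow> (nat \<Rightarrow> complex) \<Rightarrow> real \<Rightarrow> (int \<times> int \<Rightarrow> complex) \<Rightarrow> real" where
  "error_scale A B q s t c cM e =
     mu1 A B q s t * spectral_norm A B (hankel e) /
     (cM * sqrt (real (card A) * real (card B)) * Min ((\<lambda>j. cmod (c j)) ` {..<s}))"

end

theory Submission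
  imports Defs "Jordan_Normal_Form.Spectral_Radius"
begin

text \<open>
  The exact residual vanishes at the nodes, and by the growth condition its square grows at least
  quadratically there. The perturbed residual is close to it, in two senses.

  \<^item> Uniformly, with an absolute constant. The Hankel matrix of the exact data factors as
    \<open>X diag(c) Y\<^sup>*\<close> with \<open>X\<close> and \<open>Y\<close> built from the nodes, so its smallest nonzero singular
    value is at least \<open>sqrt (|A| |B|) min |c| / mu1\<close>. A perturbation argument in the style of
    Wedin (\<open>projector_perturbation\<close>) therefore moves the two projectors by at most \<open>4 \<epsilon>\<close> in
    norm, where \<open>\<epsilon> = cM * error_scale\<close>, and hence the residual by at most \<open>8 \<epsilon>\<close>
    (\<open>residual_close\<close>).

  \<^item> Together with its derivatives, with a constant depending on the configuration. The squared
    residual is a trigonometric polynomial with fixed frequencies, whose coefficients are affine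
    functions of the entries of the projectors (\<open>residual_eq_sqrt_trig\<close>).

  The second kind of closeness identifies the minima. A nonnegative trigonometric polynomial with
  nondegenerate zeros keeps, under a small change of its coefficients, exactly one local minimum near each zero,
  as its Hessian stays positive definite there, while all other values stay above those at the
  minima (\<open>trig_minima_stable\<close>). How small the change must be depends on the configuration; but
  with the constant 1 in place of \<open>C4\<close> the assumption reads \<open>\<epsilon> \<le> cM \<Delta>\<close>, so that a small \<open>c0\<close>
  makes \<open>\<epsilon>\<close> as small as needed.

  The first kind of closeness gives the rate. If \<open>p'\<close> is the minimizer near the node \<open>p\<close>, then
  the exact residual at \<open>p'\<close> is at most the perturbed one at \<open>p'\<close> plus \<open>8 \<epsilon>\<close>, hence at most the
  perturbed one at \<open>p\<close> plus \<open>8 \<epsilon>\<close>, hence at most \<open>16 \<epsilon>\<close>. The growth condition turns this into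
  \<open>d_per p' p \<le> 16 \<epsilon> / cM\<close>; the truncation at \<open>\<Delta> / 4\<close> is inactive as \<open>p'\<close>
  was found within that distance of \<open>p\<close>. This is the claim with 16 in place of \<open>C5\<close>.
\<close>

section \<open>Vectors, matrices and projectors over finite index sets\<close>

lemma vnorm_sq: "(vnorm I v)\<^sup>2 = (\<Sum>i\<in>I. (cmod (v i))\<^sup>2)"
  by (simp add: vnorm_def L2_set_def sum_nonneg)

lemma vnorm_nonneg [simp]: "0 \<le> vnorm I v"
  by (simp add: vnorm_def)

lemma vnorm_cong: "(\<And>i. i \<in> I \<Longrightarrow> u i = v i) \<Longrightarrow> vnorm I u = vnorm I v"
  by (simp add: vnorm_def cong: L2_set_cong)

lemma vinner_cong:
  "(\<And>i. i \<in> I \<Longrightarrow> u i = u' i) \<Longrightarrow> (\<And>i. i \<in> I \<Longrightarrow> v i = v' i) \<Longrightarrow> vinner I u v = vinner I u' v'"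
  by (simp add: vinner_def)

lemma mat_app_cong: "(\<And>j. j \<in> J \<Longrightarrow> u j = v j) \<Longrightarrow> mat_app J M u i = mat_app J M v i"
  by (simp add: mat_app_def)

lemma vinner_self: "vinner I v v = complex_of_real ((vnorm I v)\<^sup>2)"
  by (simp add: vnorm_sq vinner_def complex_norm_square mult.commute flip: of_real_power)

lemma cmod_vinner_self: "cmod (vinner I v v) = (vnorm I v)\<^sup>2"
  by (simp add: vinner_self norm_power)

lemma vinner_cnj: "cnj (vinner I u v) = vinner I v u"
  by (simp add: vinner_def mult.commute)

lemma vnorm_zero_iff: "finite I \<Longrightarrow> vnorm I v = 0 \<longleftrightarrow> (\<forall>i\<in>I. v i = 0)"
  by (simp add: vnorm_def L2_set_eq_0_iff)

lemma vnorm_pos: "finite I \<Longrightarrow> i \<in> I \<Longrightarrow> v i \<noteq> 0 \<Longrightarrow> 0 < vnorm I v"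
  using vnorm_zero_iff[of I v] vnorm_nonneg[of I v] by (metis less_eq_real_def)

lemma vnorm_cnj: "vnorm I (\<lambda>i. cnj (v i)) = vnorm I v"
  by (simp add: vnorm_def)

lemma vnorm_triangle: "vnorm I (\<lambda>i. u i + v i) \<le> vnorm I u + vnorm I v"
proof -
  have "vnorm I (\<lambda>i. u i + v i) \<le> L2_set (\<lambda>i. cmod (u i) + cmod (v i)) I"
    unfolding vnorm_def by (intro L2_set_mono norm_triangle_ineq norm_ge_zero)
  also have "\<dots> \<le> vnorm I u + vnorm I v"
    unfolding vnorm_def by (rule L2_set_triangle_ineq)
  finally show ?thesis .
qed

lemma vnorm_uminus: "vnorm I (\<lambda>i. - v i) = vnorm I v"
  by (simp add: vnorm_def)

lemma vnorm_triangle_diff: "vnorm I (\<lambda>i. u i - v i) \<le> vnorm I u + vnorm I v"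
  using vnorm_triangle[of I u "\<lambda>i. - v i"] by (simp add: vnorm_uminus)

lemma vnorm_scale: "vnorm I (\<lambda>i. c * v i) = cmod c * vnorm I v"
  by (simp add: vnorm_def norm_mult L2_set_right_distrib)

lemma vinner_Cauchy_Schwarz: "cmod (vinner I u v) \<le> vnorm I u * vnorm I v"
proof -
  have "cmod (vinner I u v) \<le> (\<Sum>i\<in>I. cmod (cnj (u i) * v i))"
    unfolding vinner_def by (rule norm_sum)
  also have "\<dots> = (\<Sum>i\<in>I. \<bar>cmod (u i)\<bar> * \<bar>cmod (v i)\<bar>)"
    by (simp add: norm_mult)
  also have "\<dots> \<le> vnorm I u * vnorm I v"
    unfolding vnorm_def by (rule L2_set_mult_ineq)
  finally show ?thesis .
qed

lemma vinner_diff_right: "vinner I u (\<lambda>i. v i - w i) = vinner I u v - vinner I u w"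
  by (simp add: vinner_def algebra_simps sum_subtractf)

lemma vinner_diff_left: "vinner I (\<lambda>i. v i - w i) u = vinner I v u - vinner I w u"
  by (simp add: vinner_def algebra_simps sum_subtractf)

lemma vinner_add_left: "vinner I (\<lambda>i. v i + w i) u = vinner I v u + vinner I w u"
  by (simp add: vinner_def algebra_simps sum.distrib)

lemma vinner_scale_right: "vinner I u (\<lambda>i. c * v i) = c * vinner I u v"
  by (simp add: vinner_def algebra_simps sum_distrib_left)

lemma mat_app_diff: "mat_app J M (\<lambda>j. u j - v j) i = mat_app J M u i - mat_app J M v i"
  by (simp add: mat_app_def algebra_simps sum_subtractf)

lemma mat_app_scale: "mat_app J M (\<lambda>j. c * u j) i = c * mat_app J M u i"
  by (simp add: mat_app_def algebra_simps sum_distrib_left)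

definition adj :: "('i \<Rightarrow> 'j \<Rightarrow> complex) \<Rightarrow> 'j \<Rightarrow> 'i \<Rightarrow> complex" where
  "adj M j i = cnj (M i j)"

lemma vinner_adj:
  assumes "finite I" "finite J"
  shows "vinner J (mat_app I (adj M) w) v = vinner I w (mat_app J M v)"
proof -
  have "vinner J (mat_app I (adj M) w) v = (\<Sum>j\<in>J. \<Sum>i\<in>I. cnj (w i) * M i j * v j)"
    by (simp add: vinner_def mat_app_def adj_def sum_distrib_left sum_distrib_right mult_ac)
  also have "\<dots> = (\<Sum>i\<in>I. \<Sum>j\<in>J. cnj (w i) * M i j * v j)"
    by (rule sum.swap)
  also have "\<dots> = vinner I w (mat_app J M v)"
    by (simp add: vinner_def mat_app_def sum_distrib_left mult_ac)
  finally show ?thesis .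
qed

text \<open>Testing against the vector itself turns a bound on an inner product into a bound on
  the norm; most norm estimates below end this way.\<close>

lemma le_of_square_le:
  fixes x y :: real
  assumes "x\<^sup>2 \<le> y * x" "0 \<le> x" "0 \<le> y"
  shows "x \<le> y"
  using assms by (cases "x = 0") (auto simp: power2_eq_square)

lemma vnorm_adj_le:
  assumes fin: "finite I" "finite J"
    and e: "\<And>v. vnorm I (mat_app J M v) \<le> e * vnorm J v" and e0: "0 \<le> e"
  shows "vnorm J (mat_app I (adj M) w) \<le> e * vnorm I w"
proof (rule le_of_square_le)
  let ?v = "mat_app I (adj M) w"
  have "(vnorm J ?v)\<^sup>2 = cmod (vinner I w (mat_app J M ?v))"
    by (simp add: vinner_self norm_power flip: vinner_adj[OF fin])
  also have "\<dots> \<le> vnorm I w * vnorm I (mat_app J M ?v)"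
    by (rule vinner_Cauchy_Schwarz)
  also have "\<dots> \<le> vnorm I w * (e * vnorm J ?v)"
    by (intro mult_left_mono e) simp
  finally show "(vnorm J ?v)\<^sup>2 \<le> e * vnorm I w * vnorm J ?v"
    by (simp add: mult_ac)
qed (use e0 in simp_all)

lemma vnorm_mat_app_bounded:
  assumes "finite I" "finite J"
  shows "vnorm I (mat_app J M v) \<le> (\<Sum>j\<in>J. vnorm I (\<lambda>i. M i j)) * vnorm J v"
proof -
  have 1: "vnorm I (mat_app K M v) \<le> (\<Sum>j\<in>K. vnorm I (\<lambda>i. M i j) * cmod (v j))" if "K \<subseteq> J" for K
    using finite_subset[OF that assms(2)]
  proof induction
    case empty
    then show ?case by (simp add: mat_app_def vnorm_def L2_set_def)
  next
    case (insert j K)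
    have "vnorm I (mat_app (insert j K) M v) = vnorm I (\<lambda>i. v j * M i j + mat_app K M v i)"
      using insert by (intro vnorm_cong) (simp add: mat_app_def mult.commute)
    also have "\<dots> \<le> vnorm I (\<lambda>i. v j * M i j) + vnorm I (mat_app K M v)"
      by (rule vnorm_triangle)
    also have "\<dots> \<le> cmod (v j) * vnorm I (\<lambda>i. M i j) + (\<Sum>j\<in>K. vnorm I (\<lambda>i. M i j) * cmod (v j))"
      using insert by (simp add: vnorm_scale)
    finally show ?case using insert by (simp add: mult.commute)
  qed
  have "cmod (v j) \<le> vnorm J v" if "j \<in> J" for j
    unfolding vnorm_def using that assms by (intro member_le_L2_set) auto
  then have "(\<Sum>j\<in>J. vnorm I (\<lambda>i. M i j) * cmod (v j)) \<le> (\<Sum>j\<in>J. vnorm I (\<lambda>i. M i j)) * vnorm J v"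
    by (auto simp: sum_distrib_right intro!: sum_mono mult_left_mono)
  with 1[of J] show ?thesis by simp
qed

lemma bdd_above_spectral_norm:
  assumes "finite I" "finite J"
  shows "bdd_above ((\<lambda>v. vnorm I (mat_app J M v)) ` {v. vnorm J v \<le> 1})"
proof (rule bdd_aboveI2)
  fix u :: "'b \<Rightarrow> complex" assume "u \<in> {v. vnorm J v \<le> 1}"
  then have "(\<Sum>j\<in>J. vnorm I (\<lambda>i. M i j)) * vnorm J u \<le> (\<Sum>j\<in>J. vnorm I (\<lambda>i. M i j)) * 1"
    by (intro mult_left_mono sum_nonneg) auto
  with vnorm_mat_app_bounded[OF assms, of M u]
  show "vnorm I (mat_app J M u) \<le> (\<Sum>j\<in>J. vnorm I (\<lambda>i. M i j))" by simp
qed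

lemma spectral_norm_bound:
  assumes "finite I" "finite J"
  shows "vnorm I (mat_app J M v) \<le> spectral_norm I J M * vnorm J v"
proof (cases "vnorm J v = 0")
  case True
  then show ?thesis using vnorm_mat_app_bounded[OF assms, of M v] by simp
next
  case False
  let ?n = "vnorm J v"
  let ?u = "\<lambda>j. complex_of_real (1 / ?n) * v j"
  have n: "?n > 0" using False vnorm_nonneg[of J v] by linarith
  have u1: "vnorm J ?u = 1" unfolding vnorm_scale using n by (simp add: norm_divide)
  have "vnorm I (mat_app J M ?u) \<le> spectral_norm I J M"
    unfolding spectral_norm_def
    by (rule cSUP_upper[OF _ bdd_above_spectral_norm[OF assms]]) (use u1 in simp)
  then have "vnorm I (mat_app J M v) / ?n \<le> spectral_norm I J M"
    unfolding mat_app_scale vnorm_scale using n by (simp add: norm_divide)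
  then show ?thesis using n by (simp add: field_simps)
qed

lemma spectral_norm_nonneg:
  assumes "finite I" "finite J"
  shows "0 \<le> spectral_norm I J M"
proof -
  have "vnorm I (mat_app J M (\<lambda>_. 0)) \<le> spectral_norm I J M"
    unfolding spectral_norm_def
    by (rule cSUP_upper[OF _ bdd_above_spectral_norm[OF assms]]) (simp add: vnorm_def L2_set_def)
  then show ?thesis using vnorm_nonneg order_trans by blast
qed

section \<open>Orthogonal projectors\<close>

lemma mat_app_in_column_space: "mat_app {..<s} V c \<in> column_space I s V"
  by (auto simp: column_space_def)

lemma column_space_diff:
  assumes "u \<in> column_space I s V" "w \<in> column_space I s V"
  shows "(\<lambda>i. u i - w i) \<in> column_space I s V"
proof -
  from assms obtain c d where "\<forall>i\<in>I. u i = mat_app {..<s} V c i" "\<forall>i\<in>I. w i = mat_app {..<s} V d i"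
    by (auto simp: column_space_def)
  then have "\<forall>i\<in>I. u i - w i = mat_app {..<s} V (\<lambda>j. c j - d j) i"
    by (simp add: mat_app_diff)
  then show ?thesis by (auto simp: column_space_def)
qed

lemma projector_in: "is_orth_projector I W P \<Longrightarrow> mat_app I P v \<in> W"
  by (simp add: is_orth_projector_def)

lemma projector_orth:
  "is_orth_projector I W P \<Longrightarrow> w \<in> W \<Longrightarrow> vinner I w (\<lambda>i. v i - mat_app I P v i) = 0"
  by (simp add: is_orth_projector_def)

lemma projector_orth2:
  assumes "is_orth_projector I W P" "w \<in> W"
  shows "vinner I w (mat_app I P v) = vinner I w v"
  using projector_orth[OF assms, of v] by (simp add: vinner_diff_right)

lemma projector_residual_sq:
  assumes "is_orth_projector I W P"
  shows "complex_of_real ((vnorm I (\<lambda>i. v i - mat_app I P v i))\<^sup>2)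
    = vinner I v (\<lambda>i. v i - mat_app I P v i)"
  unfolding vinner_self[symmetric] vinner_diff_left
  using projector_orth[OF assms projector_in[OF assms], of v v] by simp

lemma projector_residual_le:
  assumes "is_orth_projector I W P"
  shows "vnorm I (\<lambda>i. v i - mat_app I P v i) \<le> vnorm I v"
proof (rule le_of_square_le)
  let ?r = "\<lambda>i. v i - mat_app I P v i"
  have "(vnorm I ?r)\<^sup>2 = cmod (vinner I v ?r)"
    unfolding projector_residual_sq[OF assms, symmetric] by (simp add: norm_power)
  also have "\<dots> \<le> vnorm I v * vnorm I ?r" by (rule vinner_Cauchy_Schwarz)
  finally show "(vnorm I ?r)\<^sup>2 \<le> vnorm I v * vnorm I ?r" .
qed auto

lemma projector_fixes:
  assumes P: "is_orth_projector I (column_space I s V) P" and w: "w \<in> column_space I s V"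
    and I: "finite I" "i \<in> I"
  shows "mat_app I P w i = w i"
proof -
  let ?r = "\<lambda>i. w i - mat_app I P w i"
  have "vinner I ?r ?r = 0"
    by (rule projector_orth[OF P column_space_diff[OF w projector_in[OF P]]])
  then have "vnorm I ?r = 0" by (simp add: vinner_self)
  with I show ?thesis by (simp add: vnorm_zero_iff)
qed

lemma vinner_column_space:
  assumes "w \<in> column_space I s V"
    and "\<And>j. j < s \<Longrightarrow> vinner I (\<lambda>i. V i j) v = 0"
  shows "vinner I w v = 0"
proof -
  from assms(1) obtain c where c: "\<And>i. i \<in> I \<Longrightarrow> w i = mat_app {..<s} V c i"
    by (auto simp: column_space_def)
  have "vinner I w v = vinner I (mat_app {..<s} V c) v"
    by (rule vinner_cong) (simp_all add: c)
  also have "\<dots> = (\<Sum>j<s. cnj (c j) * vinner I (\<lambda>i. V i j) v)"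
    unfolding vinner_def mat_app_def
    by (simp add: sum_distrib_left sum_distrib_right mult_ac) (rule sum.swap)
  finally show ?thesis using assms(2) by simp
qed

lemma column_space_Suc:
  assumes w: "w \<in> column_space I s V" and u: "u \<in> column_space I s V"
    and v: "\<And>i. i \<in> I \<Longrightarrow> v i = w i + d * (V i s - u i)"
  shows "v \<in> column_space I (Suc s) V"
proof -
  from w u obtain c e where c: "\<forall>i\<in>I. w i = mat_app {..<s} V c i" "\<forall>i\<in>I. u i = mat_app {..<s} V e i"
    by (auto simp: column_space_def)
  have "\<forall>i\<in>I. v i = mat_app {..<Suc s} V (\<lambda>j. if j = s then d else c j - d * e j) i"
  proof
    fix i assume i: "i \<in> I"
    have "mat_app {..<Suc s} V (\<lambda>j. if j = s then d else c j - d * e j) i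
      = (\<Sum>j<s. V i j * (c j - d * e j)) + V i s * d"
      by (simp add: mat_app_def)
    also have "\<dots> = w i + d * (V i s - u i)"
      using i c by (simp add: mat_app_def algebra_simps sum_subtractf sum_distrib_left)
    finally show "v i = mat_app {..<Suc s} V (\<lambda>j. if j = s then d else c j - d * e j) i"
      using v i by simp
  qed
  then show ?thesis unfolding column_space_def by blast
qed

text \<open>One Gram--Schmidt step per column: the component \<open>u\<close> of the new column orthogonal to the
  previous ones contributes \<open>u u\<^sup>* / \<parallel>u\<parallel>\<^sup>2\<close>. If the new column depends on the previous ones, then
  \<open>u = 0\<close> and, as division by zero yields zero, the projector is not changed.\<close>

lemma orth_projector_exists:
  assumes I: "finite I"
  shows "\<exists>P. is_orth_projector I (column_space I s V) P"
proof (induction s)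
  case 0
  have "is_orth_projector I (column_space I 0 V) (\<lambda>_ _. 0)"
    by (auto simp: is_orth_projector_def column_space_def mat_app_def vinner_def)
  then show ?case by blast
next
  case (Suc s)
  then obtain P where P: "is_orth_projector I (column_space I s V) P" by blast
  define p where "p = mat_app I P (\<lambda>i. V i s)"
  define u where "u = (\<lambda>i. V i s - p i)"
  define n where "n = complex_of_real ((vnorm I u)\<^sup>2)"
  define P' where "P' = (\<lambda>i k. P i k + u i * cnj (u k) / n)"
  have p: "p \<in> column_space I s V" unfolding p_def by (rule projector_in[OF P])
  have app: "mat_app I P' v i = mat_app I P v i + vinner I u v / n * (V i s - p i)" for v i
    by (simp add: mat_app_def P'_def vinner_def algebra_simps sum.distrib u_def[symmetric]
        sum_distrib_left sum_divide_distrib)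
       (simp add: u_def algebra_simps sum_subtractf sum.distrib sum_distrib_left sum_divide_distrib diff_divide_distrib)
  have orthu: "vinner I w u = 0" if "w \<in> column_space I s V" for w
    unfolding u_def p_def by (rule projector_orth[OF P that])
  have nu: "vinner I u v / n * n = vinner I u v" for v
  proof (cases "n = 0")
    case True
    then have "vnorm I u = 0" by (simp add: n_def)
    then have "vinner I u v = 0" using vinner_Cauchy_Schwarz[of I u v] by simp
    then show ?thesis by simp
  qed simp
  have uu: "vinner I u u = n" by (simp add: vinner_self n_def)
  have res: "(\<lambda>i. v i - mat_app I P' v i)
      = (\<lambda>i. (v i - mat_app I P v i) - vinner I u v / n * u i)" for v
    by (simp add: app u_def algebra_simps)
  have orthP: "vinner I w (\<lambda>i. v i - mat_app I P' v i) = 0" if "w \<in> column_space I s V" for v w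
    unfolding res vinner_diff_right[of I w "\<lambda>i. v i - mat_app I P v i"] vinner_scale_right
    using projector_orth[OF P that] orthu[OF that] by simp
  have orthu': "vinner I u (\<lambda>i. v i - mat_app I P' v i) = 0" for v
  proof -
    have "vinner I u (mat_app I P v) = 0"
      using orthu[OF projector_in[OF P, of v]] vinner_cnj[of I "mat_app I P v" u] by simp
    then show ?thesis
      unfolding res vinner_diff_right[of I u "\<lambda>i. v i - mat_app I P v i"] vinner_scale_right uu nu
      by (simp add: vinner_diff_right)
  qed
  have "is_orth_projector I (column_space I (Suc s) V) P'"
    unfolding is_orth_projector_def
  proof (intro allI conjI ballI)
    fix v
    show "mat_app I P' v \<in> column_space I (Suc s) V"
      by (rule column_space_Suc[OF projector_in[OF P, of v] p]) (rule app)
    fix w assume "w \<in> column_space I (Suc s) V"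
    then show "vinner I w (\<lambda>i. v i - mat_app I P' v i) = 0"
    proof (rule vinner_column_space)
      fix j assume "j < Suc s"
      consider "j < s" | "j = s" using \<open>j < Suc s\<close> by linarith
      then show "vinner I (\<lambda>i. V i j) (\<lambda>i. v i - mat_app I P' v i) = 0"
      proof cases
        case 1
        have "(\<lambda>i. V i j) = mat_app {..<s} V (\<lambda>k. if k = j then 1 else 0)"
          using 1 by (simp add: fun_eq_iff mat_app_def if_distrib cong: if_cong)
        then have "(\<lambda>i. V i j) \<in> column_space I s V" using mat_app_in_column_space by metis
        then show ?thesis by (rule orthP)
      next
        case 2
        have "(\<lambda>i. V i j) = (\<lambda>i. p i + u i)" by (simp add: 2 u_def)
        then show ?thesis using orthP[OF p] orthu' by (simp add: vinner_add_left)
      qed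
    qed
  qed
  then show ?case by blast
qed

lemma is_orth_projector_orth_projector:
  "finite I \<Longrightarrow> is_orth_projector I (column_space I s V) (orth_projector I (column_space I s V))"
  unfolding orth_projector_def using someI_ex[OF orth_projector_exists] .

definition orthonormal :: "'i set \<Rightarrow> nat set \<Rightarrow> ('i \<Rightarrow> nat \<Rightarrow> complex) \<Rightarrow> bool" where
  "orthonormal I K U \<longleftrightarrow>
     (\<forall>k\<in>K. \<forall>l\<in>K. vinner I (\<lambda>i. U i k) (\<lambda>i. U i l) = (if k = l then 1 else 0))"

lemma orthonormal_subset: "orthonormal I K U \<Longrightarrow> L \<subseteq> K \<Longrightarrow> orthonormal I L U"
  unfolding orthonormal_def by blast

lemma vinner_mat_app_right:
  "vinner I u (mat_app K U z) = (\<Sum>k\<in>K. z k * vinner I u (\<lambda>i. U i k))"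
  unfolding vinner_def mat_app_def
  by (simp add: sum_distrib_left sum_distrib_right mult_ac) (rule sum.swap)

lemma vinner_orthonormal_comb:
  assumes "orthonormal I K U" "finite K" "k \<in> K"
  shows "vinner I (\<lambda>i. U i k) (mat_app K U z) = z k"
proof -
  have "(\<Sum>l\<in>K. z l * vinner I (\<lambda>i. U i k) (\<lambda>i. U i l)) = (\<Sum>l\<in>K. if l = k then z k else 0)"
    using assms by (intro sum.cong) (auto simp: orthonormal_def)
  then show ?thesis using assms by (simp add: vinner_mat_app_right)
qed

lemma vnorm_orthonormal_comb:
  assumes "orthonormal I K U" "finite K"
  shows "vnorm I (mat_app K U z) = vnorm K z"
proof -
  have "complex_of_real ((vnorm I (mat_app K U z))\<^sup>2) = (\<Sum>k\<in>K. z k * cnj (vinner I (\<lambda>i. U i k) (mat_app K U z)))"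
    unfolding vinner_self[symmetric] vinner_cnj by (rule vinner_mat_app_right)
  also have "\<dots> = (\<Sum>k\<in>K. z k * cnj (z k))"
    by (intro sum.cong) (simp_all add: vinner_orthonormal_comb[OF assms])
  also have "\<dots> = complex_of_real ((vnorm K z)\<^sup>2)"
    unfolding vinner_self[symmetric] by (simp add: vinner_def mult.commute)
  finally show ?thesis by (metis of_real_eq_iff power2_eq_iff_nonneg vnorm_nonneg)
qed

lemma mat_app_leading_projector:
  "mat_app I (leading_projector s U) v = mat_app {..<s} U (\<lambda>k. vinner I (\<lambda>i. U i k) v)"
proof
  fix i
  show "mat_app I (leading_projector s U) v i = mat_app {..<s} U (\<lambda>k. vinner I (\<lambda>i. U i k) v) i"
    unfolding mat_app_def leading_projector_def vinner_def
    by (simp add: sum_distrib_left sum_distrib_right mult_ac) (rule sum.swap)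
qed

lemma leading_projector_is_orth_projector:
  assumes "orthonormal I {..<s} U"
  shows "is_orth_projector I (column_space I s U) (leading_projector s U)"
  unfolding is_orth_projector_def
proof (intro allI conjI ballI)
  fix v
  show "mat_app I (leading_projector s U) v \<in> column_space I s U"
    unfolding mat_app_leading_projector by (rule mat_app_in_column_space)
  fix w assume "w \<in> column_space I s U"
  then show "vinner I w (\<lambda>i. v i - mat_app I (leading_projector s U) v i) = 0"
    by (rule vinner_column_space)
       (simp add: vinner_diff_right mat_app_leading_projector vinner_orthonormal_comb[OF assms])
qed

lemma Bessel_inequality:
  assumes "orthonormal I K U" "finite K"
  shows "vnorm K (\<lambda>k. vinner I (\<lambda>i. U i k) v) \<le> vnorm I v"
proof (rule le_of_square_le)
  let ?z = "\<lambda>k. vinner I (\<lambda>i. U i k) v"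
  have "complex_of_real ((vnorm K ?z)\<^sup>2) = vinner I v (mat_app K U ?z)"
    unfolding vinner_self[symmetric] vinner_mat_app_right vinner_cnj[of I _ v, symmetric]
    by (simp add: vinner_def[of K] mult.commute)
  then have "(vnorm K ?z)\<^sup>2 = cmod (vinner I v (mat_app K U ?z))"
    by (metis abs_of_nonneg norm_of_real zero_le_power2)
  also have "\<dots> \<le> vnorm I v * vnorm I (mat_app K U ?z)" by (rule vinner_Cauchy_Schwarz)
  finally show "(vnorm K ?z)\<^sup>2 \<le> vnorm I v * vnorm K ?z"
    by (simp add: vnorm_orthonormal_comb[OF assms])
qed auto

section \<open>Perturbation of singular subspaces\<close>

text \<open>Dimension counts enter the proof only in this form: fewer equations than unknowns.\<close>

lemma homogeneous_system_nontrivial: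
  assumes "finite R" "card R < s"
  obtains y :: "nat \<Rightarrow> complex" where "\<exists>j<s. y j \<noteq> 0" "\<And>i. i \<in> R \<Longrightarrow> mat_app {..<s} M y i = 0"
proof -
  obtain f where f: "bij_betw f {..<card R} R"
    using ex_bij_betw_nat_finite[OF assms(1)] by (auto simp: atLeast0LessThan)
  define A where "A = Matrix.mat s s (\<lambda>(i, j). if i < card R then M (f i) j else 0)"
  have A: "A \<in> carrier_mat s s" by (simp add: A_def)
  \<comment> \<open>The last row of \<open>A\<close> vanishes, so its transpose annihilates the last unit vector.\<close>
  have "transpose_mat A *\<^sub>v unit_vec s (s - 1) = 0\<^sub>v s"
    using assms(2) by (intro eq_vecI) (auto simp: A_def scalar_prod_def unit_vec_def intro!: sum.neutral)
  moreover have "unit_vec s (s - 1) \<noteq> (0\<^sub>v s :: complex vec)"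
  proof
    assume "unit_vec s (s - 1) = (0\<^sub>v s :: complex vec)"
    then have "unit_vec s (s - 1) $ (s - 1) = (0\<^sub>v s :: complex vec) $ (s - 1)" by simp
    then show False using assms(2) by (simp add: unit_vec_def)
  qed
  moreover have "unit_vec s (s - 1) \<in> (carrier_vec s :: complex vec set)" by simp
  ultimately have "\<exists>v. v \<in> carrier_vec s \<and> v \<noteq> 0\<^sub>v s \<and> transpose_mat A *\<^sub>v v = 0\<^sub>v s" by blast
  moreover have "transpose_mat A \<in> carrier_mat s s" using A by simp
  ultimately have "det (transpose_mat A) = 0" by (simp add: det_0_iff_vec_prod_zero_field)
  then have "det A = 0" using det_transpose[OF A] by simp
  then obtain v where v: "v \<in> carrier_vec s" "v \<noteq> 0\<^sub>v s" "A *\<^sub>v v = 0\<^sub>v s"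
    using det_0_iff_vec_prod_zero_field[OF A] by blast
  show thesis
  proof
    show "\<exists>j<s. v $ j \<noteq> 0" using v(1,2) by (auto simp: vec_eq_iff)
    fix i assume "i \<in> R"
    then obtain k where k: "k < card R" "i = f k" using f by (auto simp: bij_betw_def)
    then have ks: "k < s" using assms(2) by simp
    have "(A *\<^sub>v v) $ k = 0" using v(3) ks by simp
    then show "mat_app {..<s} M (\<lambda>j. v $ j) i = 0"
      using k ks v(1) by (simp add: A_def scalar_prod_def mat_app_def atLeast0LessThan)
  qed
qed

lemma vnorm_mono_scaled:
  assumes "\<And>i. i \<in> I \<Longrightarrow> cmod (u i) \<le> c * cmod (v i)" "0 \<le> c"
  shows "vnorm I u \<le> c * vnorm I v"
  using assms unfolding vnorm_def L2_set_right_distrib[OF assms(2)] by (intro L2_set_mono) auto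

lemma vnorm_mono_scaled_ge:
  assumes "\<And>i. i \<in> I \<Longrightarrow> c * cmod (v i) \<le> cmod (u i)" "0 \<le> c"
  shows "c * vnorm I v \<le> vnorm I u"
  using assms unfolding vnorm_def L2_set_right_distrib[OF assms(2)] by (intro L2_set_mono) auto

lemma vnorm_extend_zero:
  fixes s r :: nat
  shows "s \<le> r \<Longrightarrow> vnorm {..<r} (\<lambda>k. if k < s then z k else 0) = vnorm {..<s} z"
proof -
  assume "s \<le> r"
  have "(\<Sum>k<r. (cmod (if k < s then z k else 0))\<^sup>2) = (\<Sum>k<s. (cmod (z k))\<^sup>2)"
    using \<open>s \<le> r\<close> by (intro sum.mono_neutral_cong_right) auto
  then show ?thesis by (simp add: vnorm_def L2_set_def)
qed

lemma mat_app_extend_zero: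
  fixes s r :: nat
  shows "s \<le> r \<Longrightarrow> mat_app {..<r} U (\<lambda>k. if k < s then z k else 0) = mat_app {..<s} U z"
  unfolding mat_app_def fun_eq_iff by (intro allI impI sum.mono_neutral_cong_right) auto

text \<open>A lower bound for the synthesis map \<open>c \<mapsto> X c\<close> passes to its adjoint on the range, because
  \<open>\<parallel>X c\<parallel>\<^sup>2 = \<langle>X\<^sup>* X c, c\<rangle>\<close>.\<close>

lemma coefficient_norm_ge:
  assumes lower: "\<And>c. a * vnorm {..<s} c \<le> vnorm I (mat_app {..<s} X c)" and a: "0 \<le> a"
    and w: "w \<in> column_space I s X"
  shows "a * vnorm I w \<le> vnorm {..<s} (\<lambda>k. vinner I (\<lambda>i. X i k) w)"
proof (rule le_of_square_le)
  let ?z = "\<lambda>k. vinner I (\<lambda>i. X i k) w"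
  from w obtain c where c: "\<And>i. i \<in> I \<Longrightarrow> w i = mat_app {..<s} X c i"
    by (auto simp: column_space_def)
  have "(vnorm I w)\<^sup>2 = cmod (vinner I w (mat_app {..<s} X c))"
    unfolding cmod_vinner_self[symmetric] by (rule arg_cong[where f = cmod], rule vinner_cong) (simp_all add: c)
  also have "\<dots> = cmod (vinner {..<s} ?z c)"
    unfolding vinner_mat_app_right vinner_cnj[of I _ w, symmetric] by (simp add: vinner_def[of "{..<s}"] mult.commute)
  also have "\<dots> \<le> vnorm {..<s} ?z * vnorm {..<s} c" by (rule vinner_Cauchy_Schwarz)
  finally have "a * (vnorm I w)\<^sup>2 \<le> vnorm {..<s} ?z * (a * vnorm {..<s} c)"
    using a by (metis mult.left_commute mult_left_mono)
  also have "\<dots> \<le> vnorm {..<s} ?z * vnorm I w"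
    using lower[of c] vnorm_cong[of I w "mat_app {..<s} X c"] c by (simp add: mult_left_mono)
  finally have "a * (a * (vnorm I w)\<^sup>2) \<le> a * (vnorm {..<s} ?z * vnorm I w)"
    using a by (rule mult_left_mono)
  then show "(a * vnorm I w)\<^sup>2 \<le> vnorm {..<s} ?z * (a * vnorm I w)"
    by (simp add: power2_eq_square mult_ac)
qed (use a in simp_all)

text \<open>The setting is a matrix \<open>H = X diag(d) Y\<^sup>*\<close> of rank \<open>s\<close> and an arbitrary matrix \<open>M\<close> near it, given
  through a singular value decomposition. As \<open>a\<close> and \<open>b\<close> bound the smallest singular values of
  the factors from below, \<open>a b m\<close> bounds that of \<open>H\<close>.\<close>

locale perturbed_factorization =
  fixes I :: "'i set" and J :: "'j set" and s :: nat
    and X :: "'i \<Rightarrow> nat \<Rightarrow> complex" and d :: "nat \<Rightarrow> complex" and Y :: "'j \<Rightarrow> nat \<Rightarrow> complex"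
    and H M :: "'i \<Rightarrow> 'j \<Rightarrow> complex"
    and U :: "'i \<Rightarrow> nat \<Rightarrow> complex" and \<sigma> :: "nat \<Rightarrow> real" and V :: "'j \<Rightarrow> nat \<Rightarrow> complex"
    and a b m e :: real
  assumes fin: "finite I" "finite J" and s: "1 \<le> s"
    and H: "\<And>i j. i \<in> I \<Longrightarrow> j \<in> J \<Longrightarrow> H i j = (\<Sum>k<s. X i k * d k * cnj (Y j k))"
    and X_lower: "\<And>c. a * vnorm {..<s} c \<le> vnorm I (mat_app {..<s} X c)"
    and Y_lower: "\<And>c. b * vnorm {..<s} c \<le> vnorm J (mat_app {..<s} Y c)"
    and d_lower: "\<And>k. k < s \<Longrightarrow> m \<le> cmod (d k)"
    and pos: "0 < a" "0 < b" "0 < m"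
    and svd: "is_svd I J M U \<sigma> V"
    and e: "\<And>v. vnorm I (mat_app J (\<lambda>i j. M i j - H i j) v) \<le> e * vnorm J v"
    and e_small: "0 \<le> e" "2 * e \<le> a * b * m"
begin

abbreviation "r \<equiv> min (card I) (card J)"

lemma lower_imp_card_ge:
  assumes "finite K" "0 < a'" "\<And>c. a' * vnorm {..<s} c \<le> vnorm K (mat_app {..<s} Z c)"
  shows "s \<le> card K"
proof (rule ccontr)
  assume "\<not> s \<le> card K"
  then have "card K < s" by simp
  from homogeneous_system_nontrivial[OF assms(1) this, of Z] obtain y
    where y: "\<exists>j<s. y j \<noteq> 0" "\<And>i. i \<in> K \<Longrightarrow> mat_app {..<s} Z y i = 0" by blast
  have "vnorm K (mat_app {..<s} Z y) = 0" using assms(1) y(2) by (simp add: vnorm_zero_iff)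
  moreover have "0 < vnorm {..<s} y" using y(1) by (auto intro: vnorm_pos)
  ultimately show False
    using assms(3)[of y] mult_pos_pos[OF assms(2), of "vnorm {..<s} y"] by linarith
qed

lemma s_le_r: "s \<le> r"
  using lower_imp_card_ge[OF fin(1) pos(1) X_lower] lower_imp_card_ge[OF fin(2) pos(2) Y_lower] by simp

lemma orthonormal_U: "orthonormal I {..<r} U" and orthonormal_V: "orthonormal J {..<r} V"
  using svd by (simp_all add: is_svd_def orthonormal_def Let_def)

lemma orthonormal_U_s: "orthonormal I {..<s} U"
  using orthonormal_subset[OF orthonormal_U] s_le_r by auto

lemma \<sigma>_nonneg: "k < r \<Longrightarrow> 0 \<le> \<sigma> k" and \<sigma>_mono: "k \<le> l \<Longrightarrow> l < r \<Longrightarrow> \<sigma> l \<le> \<sigma> k"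
  using svd by (auto simp: is_svd_def Let_def)

lemma M_app:
  assumes "i \<in> I"
  shows "mat_app J M v i = mat_app {..<r} U (\<lambda>k. \<sigma> k * vinner J (\<lambda>j. V j k) v) i"
proof -
  have "mat_app J M v i = (\<Sum>j\<in>J. (\<Sum>k<r. U i k * complex_of_real (\<sigma> k) * cnj (V j k)) * v j)"
    unfolding mat_app_def using svd assms by (intro sum.cong) (auto simp: is_svd_def Let_def)
  also have "\<dots> = (\<Sum>k<r. \<Sum>j\<in>J. U i k * complex_of_real (\<sigma> k) * cnj (V j k) * v j)"
    unfolding sum_distrib_right by (rule sum.swap)
  finally show ?thesis by (simp add: mat_app_def vinner_def sum_distrib_left mult_ac)
qed

lemma M_adj_app:
  assumes "j \<in> J"
  shows "mat_app I (adj M) w j = mat_app {..<r} V (\<lambda>k. \<sigma> k * vinner I (\<lambda>i. U i k) w) j"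
proof -
  have "mat_app I (adj M) w j = (\<Sum>i\<in>I. cnj (\<Sum>k<r. U i k * complex_of_real (\<sigma> k) * cnj (V j k)) * w i)"
    unfolding mat_app_def adj_def using svd assms by (intro sum.cong) (auto simp: is_svd_def Let_def)
  also have "\<dots> = (\<Sum>k<r. \<Sum>i\<in>I. cnj (U i k) * complex_of_real (\<sigma> k) * V j k * w i)"
    unfolding cnj_sum sum_distrib_right by (subst sum.swap) simp
  finally show ?thesis by (simp add: mat_app_def vinner_def sum_distrib_left mult_ac)
qed

lemma H_app:
  assumes "i \<in> I"
  shows "mat_app J H v i = mat_app {..<s} X (\<lambda>k. d k * vinner J (\<lambda>j. Y j k) v) i"
proof -
  have "mat_app J H v i = (\<Sum>j\<in>J. (\<Sum>k<s. X i k * d k * cnj (Y j k)) * v j)"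
    unfolding mat_app_def using H assms by (intro sum.cong) auto
  also have "\<dots> = (\<Sum>k<s. \<Sum>j\<in>J. X i k * d k * cnj (Y j k) * v j)"
    unfolding sum_distrib_right by (rule sum.swap)
  finally show ?thesis by (simp add: mat_app_def vinner_def sum_distrib_left mult_ac)
qed

lemma H_adj_app:
  assumes "j \<in> J"
  shows "mat_app I (adj H) w j = mat_app {..<s} Y (\<lambda>k. cnj (d k) * vinner I (\<lambda>i. X i k) w) j"
proof -
  have "mat_app I (adj H) w j = (\<Sum>i\<in>I. cnj (\<Sum>k<s. X i k * d k * cnj (Y j k)) * w i)"
    unfolding mat_app_def adj_def using H assms by (intro sum.cong) auto
  also have "\<dots> = (\<Sum>k<s. \<Sum>i\<in>I. cnj (X i k) * cnj (d k) * Y j k * w i)"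
    unfolding cnj_sum sum_distrib_right by (subst sum.swap) simp
  finally show ?thesis by (simp add: mat_app_def vinner_def sum_distrib_left mult_ac)
qed

lemma H_in_column_space: "mat_app J H v \<in> column_space I s X"
  using H_app by (auto simp: column_space_def)

lemma H_lower:
  assumes "x \<in> column_space J s Y"
  shows "a * b * m * vnorm J x \<le> vnorm I (mat_app J H x)"
proof -
  let ?z = "\<lambda>k. vinner J (\<lambda>j. Y j k) x"
  have "a * b * m * vnorm J x = a * (m * (b * vnorm J x))" by simp
  also have "\<dots> \<le> a * (m * vnorm {..<s} ?z)"
    using pos by (intro mult_left_mono coefficient_norm_ge[OF Y_lower _ assms]) auto
  also have "\<dots> \<le> a * vnorm {..<s} (\<lambda>k. d k * ?z k)"
    using pos d_lower by (intro mult_left_mono vnorm_mono_scaled_ge) (auto simp: norm_mult mult_right_mono)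
  also have "\<dots> \<le> vnorm I (mat_app J H x)"
    using X_lower[of "\<lambda>k. d k * ?z k"] vnorm_cong[of I "mat_app J H x", OF H_app] by simp
  finally show ?thesis .
qed

lemma H_adj_lower:
  assumes P: "is_orth_projector I (column_space I s X) P"
  shows "a * b * m * vnorm I (mat_app I P w) \<le> vnorm J (mat_app I (adj H) w)"
proof -
  let ?z = "\<lambda>k. vinner I (\<lambda>i. X i k) w"
  have z: "vinner I (\<lambda>i. X i k) (mat_app I P w) = ?z k" if "k < s" for k
  proof (rule projector_orth2[OF P])
    have "(\<lambda>i. X i k) = mat_app {..<s} X (\<lambda>l. if l = k then 1 else 0)"
      using that by (simp add: fun_eq_iff mat_app_def if_distrib cong: if_cong)
    then show "(\<lambda>i. X i k) \<in> column_space I s X" using mat_app_in_column_space by metis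
  qed
  have "a * b * m * vnorm I (mat_app I P w) = b * (m * (a * vnorm I (mat_app I P w)))" by simp
  also have "\<dots> \<le> b * (m * vnorm {..<s} (\<lambda>k. vinner I (\<lambda>i. X i k) (mat_app I P w)))"
    using pos by (intro mult_left_mono coefficient_norm_ge[OF X_lower _ projector_in[OF P]]) auto
  also have "\<dots> = b * (m * vnorm {..<s} ?z)"
    using vnorm_cong[of "{..<s}", OF z] by simp
  also have "\<dots> \<le> b * vnorm {..<s} (\<lambda>k. cnj (d k) * ?z k)"
    using pos d_lower by (intro mult_left_mono vnorm_mono_scaled_ge) (auto simp: norm_mult mult_right_mono)
  also have "\<dots> \<le> vnorm J (mat_app I (adj H) w)"
    using Y_lower[of "\<lambda>k. cnj (d k) * ?z k"] vnorm_cong[of J "mat_app I (adj H) w", OF H_adj_app] by simp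
  finally show ?thesis .
qed

lemma M_split: "mat_app J M v i = mat_app J H v i + mat_app J (\<lambda>i j. M i j - H i j) v i"
  by (simp add: mat_app_def algebra_simps sum_subtractf)

lemma vnorm_M: "vnorm I (mat_app J M v) = vnorm {..<r} (\<lambda>k. \<sigma> k * vinner J (\<lambda>j. V j k) v)"
  by (rule trans[OF vnorm_cong[OF M_app] vnorm_orthonormal_comb[OF orthonormal_U finite_lessThan]])

lemma vnorm_M_adj: "vnorm J (mat_app I (adj M) w) = vnorm {..<r} (\<lambda>k. \<sigma> k * vinner I (\<lambda>i. U i k) w)"
  by (rule trans[OF vnorm_cong[OF M_adj_app] vnorm_orthonormal_comb[OF orthonormal_V finite_lessThan]])

text \<open>Weyl's bound: some nonzero vector in the span of the first \<open>s + 1\<close> right singular vectors of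
  \<open>M\<close> lies in the kernel of \<open>H\<close>, and there \<open>M\<close> acts as \<open>M - H\<close>.\<close>

lemma \<sigma>_tail_le:
  assumes "s \<le> k" "k < r"
  shows "\<sigma> k \<le> e"
proof -
  have sr: "Suc s \<le> r" using assms by simp
  obtain y where y: "\<exists>j<Suc s. y j \<noteq> 0"
      "\<And>k. k \<in> {..<s} \<Longrightarrow> mat_app {..<Suc s} (\<lambda>k l. vinner J (\<lambda>j. Y j k) (\<lambda>j. V j l)) y k = 0"
    by (rule homogeneous_system_nontrivial[of "{..<s}" "Suc s"
          "\<lambda>k l. vinner J (\<lambda>j. Y j k) (\<lambda>j. V j l)"]) auto
  define y' where "y' = (\<lambda>k. if k < Suc s then y k else 0)"
  define x where "x = mat_app {..<r} V y'"
  have x_eq: "x = mat_app {..<Suc s} V y"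
    unfolding x_def y'_def by (rule mat_app_extend_zero[OF sr])
  have "vinner J (\<lambda>j. Y j k) x = 0" if "k < s" for k
    using y(2)[of k] that by (simp add: x_eq vinner_mat_app_right mat_app_def mult.commute)
  then have "mat_app J H x i = 0" if "i \<in> I" for i
    using that by (simp add: H_app) (simp add: mat_app_def)
  then have "vnorm I (mat_app J M x) = vnorm I (mat_app J (\<lambda>i j. M i j - H i j) x)"
    by (intro vnorm_cong) (simp add: M_split)
  also have "\<dots> \<le> e * vnorm J x" by (rule e)
  finally have 1: "vnorm I (mat_app J M x) \<le> e * vnorm J x" .
  have nx: "vnorm J x = vnorm {..<r} y'"
    unfolding x_def by (rule vnorm_orthonormal_comb[OF orthonormal_V]) simp
  have "\<sigma> s * vnorm {..<r} y' \<le> vnorm {..<r} (\<lambda>k. \<sigma> k * y' k)"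
  proof (rule vnorm_mono_scaled_ge)
    fix k assume k: "k \<in> {..<r}"
    show "\<sigma> s * cmod (y' k) \<le> cmod (complex_of_real (\<sigma> k) * y' k)"
    proof (cases "k < Suc s")
      case True
      then show ?thesis using \<sigma>_mono[of k s] \<sigma>_nonneg[of k] sr k
        by (simp add: norm_mult mult_right_mono)
    qed (simp add: y'_def)
  qed (use \<sigma>_nonneg[of s] sr in simp)
  also have "\<dots> = vnorm I (mat_app J M x)"
    unfolding vnorm_M x_def
    by (rule vnorm_cong) (simp add: vinner_orthonormal_comb[OF orthonormal_V])
  finally have "\<sigma> s * vnorm J x \<le> e * vnorm J x" using 1 nx by simp
  moreover have "vnorm J x > 0"
  proof -
    have "0 < vnorm {..<Suc s} y" using y(1) by (auto intro: vnorm_pos)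
    moreover have "vnorm {..<r} y' = vnorm {..<Suc s} y"
      unfolding y'_def by (rule vnorm_extend_zero[OF sr])
    ultimately show ?thesis using nx by simp
  qed
  ultimately have "\<sigma> s \<le> e" by simp
  then show ?thesis using \<sigma>_mono[OF assms] by simp
qed

text \<open>Weyl's bound from below: some nonzero vector in the range of \<open>Y\<close> is orthogonal to the first
  \<open>s - 1\<close> right singular vectors of \<open>M\<close>, and there \<open>M\<close> expands at most by its \<open>s\<close>th singular
  value.\<close>

lemma \<sigma>_head_ge:
  assumes "k < s"
  shows "a * b * m - e \<le> \<sigma> k"
proof -
  have s1: "s - 1 < r" "Suc (s - 1) = s" using s s_le_r by auto
  obtain y where y: "\<exists>j<s. y j \<noteq> 0"
      "\<And>k. k \<in> {..<s - 1} \<Longrightarrow> mat_app {..<s} (\<lambda>k l. vinner J (\<lambda>j. V j k) (\<lambda>j. Y j l)) y k = 0"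
    by (rule homogeneous_system_nontrivial[of "{..<s - 1}" s
          "\<lambda>k l. vinner J (\<lambda>j. V j k) (\<lambda>j. Y j l)"]) (use s in auto)
  define x where "x = mat_app {..<s} Y y"
  have orth: "vinner J (\<lambda>j. V j k) x = 0" if "k < s - 1" for k
    using y(2)[of k] that by (simp add: x_def vinner_mat_app_right mat_app_def mult.commute)
  have "vnorm I (mat_app J M x) \<le> \<sigma> (s - 1) * vnorm {..<r} (\<lambda>k. vinner J (\<lambda>j. V j k) x)"
    unfolding vnorm_M
  proof (rule vnorm_mono_scaled)
    fix k assume k: "k \<in> {..<r}"
    show "cmod (complex_of_real (\<sigma> k) * vinner J (\<lambda>j. V j k) x)
      \<le> \<sigma> (s - 1) * cmod (vinner J (\<lambda>j. V j k) x)"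
      using orth[of k] \<sigma>_mono[of "s - 1" k] \<sigma>_nonneg[of k] k
      by (cases "k < s - 1") (auto simp: norm_mult mult_right_mono)
  qed (use \<sigma>_nonneg[OF s1(1)] in simp)
  also have "\<dots> \<le> \<sigma> (s - 1) * vnorm J x"
    using \<sigma>_nonneg[OF s1(1)] by (intro mult_left_mono Bessel_inequality[OF orthonormal_V]) auto
  finally have 1: "vnorm I (mat_app J M x) \<le> \<sigma> (s - 1) * vnorm J x" .
  have "a * b * m * vnorm J x \<le> vnorm I (mat_app J H x)"
    unfolding x_def by (rule H_lower[OF mat_app_in_column_space])
  also have "\<dots> = vnorm I (\<lambda>i. mat_app J M x i - mat_app J (\<lambda>i j. M i j - H i j) x i)"
    by (simp add: M_split)
  also have "\<dots> \<le> vnorm I (mat_app J M x) + vnorm I (mat_app J (\<lambda>i j. M i j - H i j) x)"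
    by (rule vnorm_triangle_diff)
  also have "\<dots> \<le> (\<sigma> (s - 1) + e) * vnorm J x"
    using 1 e[of x] by (simp add: algebra_simps)
  finally have "a * b * m * vnorm J x \<le> (\<sigma> (s - 1) + e) * vnorm J x" .
  moreover have "vnorm J x > 0"
  proof -
    have "vnorm {..<s} y > 0" using y(1) by (auto intro: vnorm_pos)
    then have "b * vnorm {..<s} y > 0" using pos by simp
    then show ?thesis using Y_lower[of y] unfolding x_def by linarith
  qed
  ultimately have "a * b * m \<le> \<sigma> (s - 1) + e" by simp
  moreover have "\<sigma> (s - 1) \<le> \<sigma> k" using assms s1 by (intro \<sigma>_mono) auto
  ultimately show ?thesis by simp
qed

lemma \<sigma>_head_ge_half: "k < s \<Longrightarrow> a * b * m / 2 \<le> \<sigma> k"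
  using \<sigma>_head_ge[of k] e_small by simp

text \<open>Every vector in the leading left singular space is \<open>M y\<close> with \<open>y\<close> of controlled size, and
  \<open>M y\<close> differs from \<open>H y\<close>, which the projector onto the range of \<open>X\<close> fixes, by \<open>(M - H) y\<close>.\<close>

lemma leading_space_near_column_space:
  assumes P: "is_orth_projector I (column_space I s X) P"
  defines "Q \<equiv> leading_projector s U"
  shows "vnorm I (\<lambda>i. mat_app I Q v i - mat_app I P (mat_app I Q v) i)
    \<le> 2 * e / (a * b * m) * vnorm I v"
proof -
  let ?E = "\<lambda>i j. M i j - H i j" and ?g = "a * b * m"
  have g: "?g > 0" using pos by simp
  define z where "z = (\<lambda>k. vinner I (\<lambda>i. U i k) v)"
  define y where "y = mat_app {..<r} V (\<lambda>k. if k < s then z k / \<sigma> k else 0)"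
  have \<sigma>pos: "\<sigma> k > 0" if "k < s" for k using \<sigma>_head_ge_half[OF that] g by linarith
  have My: "mat_app J M y i = mat_app I Q v i" if "i \<in> I" for i
  proof -
    have "mat_app J M y i = mat_app {..<r} U (\<lambda>k. if k < s then z k else 0) i"
      unfolding M_app[OF that]
    proof (rule mat_app_cong)
      fix k assume "k \<in> {..<r}"
      then have "vinner J (\<lambda>j. V j k) y = (if k < s then z k / \<sigma> k else 0)"
        unfolding y_def by (intro vinner_orthonormal_comb[OF orthonormal_V]) auto
      then show "\<sigma> k * vinner J (\<lambda>j. V j k) y = (if k < s then z k else 0)"
        using \<sigma>pos[of k] by auto
    qed
    also have "\<dots> = mat_app I Q v i"
      unfolding Q_def mat_app_leading_projector mat_app_extend_zero[OF s_le_r] z_def ..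
    finally show ?thesis .
  qed
  have "vnorm J y = vnorm {..<s} (\<lambda>k. z k / \<sigma> k)"
    unfolding y_def vnorm_orthonormal_comb[OF orthonormal_V finite_lessThan]
    by (rule vnorm_extend_zero[OF s_le_r])
  also have "\<dots> \<le> (2 / ?g) * vnorm {..<s} z"
  proof (rule vnorm_mono_scaled)
    fix k assume "k \<in> {..<s}"
    then have k: "?g / 2 \<le> \<sigma> k" "\<sigma> k > 0" using \<sigma>_head_ge_half \<sigma>pos by auto
    have "1 / \<sigma> k \<le> 1 / (?g / 2)" using k g by (intro divide_left_mono) auto
    then have "1 / \<sigma> k * cmod (z k) \<le> 2 / ?g * cmod (z k)" by (intro mult_right_mono) auto
    then show "cmod (z k / complex_of_real (\<sigma> k)) \<le> 2 / ?g * cmod (z k)"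
      using k by (simp add: norm_divide)
  qed (use g in simp)
  also have "\<dots> \<le> (2 / ?g) * vnorm I v"
    unfolding z_def using g by (intro mult_left_mono Bessel_inequality[OF orthonormal_U_s]) auto
  finally have ny: "vnorm J y \<le> 2 / ?g * vnorm I v" .
  have "mat_app I Q v i - mat_app I P (mat_app I Q v) i
      = mat_app J ?E y i - mat_app I P (mat_app J ?E y) i" if i: "i \<in> I" for i
  proof -
    have 1: "mat_app I P (mat_app I Q v) i = mat_app I P (mat_app J M y) i"
      by (rule mat_app_cong) (simp add: My)
    have "mat_app I P (mat_app J ?E y) i = mat_app I P (\<lambda>i. mat_app J M y i - mat_app J H y i) i"
      by (rule mat_app_cong) (simp add: M_split)
    also have "\<dots> = mat_app I P (mat_app J M y) i - mat_app J H y i"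
      by (simp add: mat_app_diff projector_fixes[OF P H_in_column_space fin(1) i])
    finally show ?thesis unfolding 1 My[OF i, symmetric] by (simp add: M_split)
  qed
  then have "vnorm I (\<lambda>i. mat_app I Q v i - mat_app I P (mat_app I Q v) i)
      = vnorm I (\<lambda>i. mat_app J ?E y i - mat_app I P (mat_app J ?E y) i)"
    by (rule vnorm_cong)
  also have "\<dots> \<le> vnorm I (mat_app J ?E y)" by (rule projector_residual_le[OF P])
  also have "\<dots> \<le> e * vnorm J y" by (rule e)
  also have "\<dots> \<le> e * (2 / ?g * vnorm I v)" using ny e_small by (intro mult_left_mono)
  finally show ?thesis by (simp add: mult_ac)
qed

text \<open>For \<open>w\<close> orthogonal to the leading left singular vectors, \<open>M\<^sup>* w\<close> only involves the
  small singular values, hence \<open>H\<^sup>* w\<close> is small; but \<open>H\<^sup>*\<close> is bounded below on the range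
  of \<open>X\<close>.\<close>

lemma column_space_near_leading_space:
  assumes P: "is_orth_projector I (column_space I s X) P"
  defines "Q \<equiv> leading_projector s U"
  shows "vnorm I (mat_app I P (\<lambda>i. v i - mat_app I Q v i)) \<le> 2 * e / (a * b * m) * vnorm I v"
proof -
  let ?E = "\<lambda>i j. M i j - H i j" and ?g = "a * b * m"
  have g: "?g > 0" using pos by simp
  have Q: "is_orth_projector I (column_space I s U) Q"
    unfolding Q_def by (rule leading_projector_is_orth_projector[OF orthonormal_U_s])
  define w where "w = (\<lambda>i. v i - mat_app I Q v i)"
  have w: "vnorm I w \<le> vnorm I v" unfolding w_def by (rule projector_residual_le[OF Q])
  have orth: "vinner I (\<lambda>i. U i k) w = 0" if "k < s" for k
    unfolding w_def
  proof (rule projector_orth[OF Q])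
    have "(\<lambda>i. U i k) = mat_app {..<s} U (\<lambda>l. if l = k then 1 else 0)"
      using that by (simp add: fun_eq_iff mat_app_def if_distrib cong: if_cong)
    then show "(\<lambda>i. U i k) \<in> column_space I s U" using mat_app_in_column_space by metis
  qed
  have "vnorm J (mat_app I (adj M) w) \<le> e * vnorm {..<r} (\<lambda>k. vinner I (\<lambda>i. U i k) w)"
    unfolding vnorm_M_adj
  proof (rule vnorm_mono_scaled)
    fix k assume k: "k \<in> {..<r}"
    show "cmod (complex_of_real (\<sigma> k) * vinner I (\<lambda>i. U i k) w) \<le> e * cmod (vinner I (\<lambda>i. U i k) w)"
      using orth[of k] \<sigma>_tail_le[of k] \<sigma>_nonneg[of k] k
      by (cases "k < s") (auto simp: norm_mult mult_right_mono)
  qed (rule e_small)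
  also have "\<dots> \<le> e * vnorm I w"
    using e_small by (intro mult_left_mono Bessel_inequality[OF orthonormal_U]) auto
  finally have 1: "vnorm J (mat_app I (adj M) w) \<le> e * vnorm I w" .
  have "?g * vnorm I (mat_app I P w) \<le> vnorm J (mat_app I (adj H) w)" by (rule H_adj_lower[OF P])
  also have "\<dots> = vnorm J (\<lambda>j. mat_app I (adj M) w j - mat_app I (adj ?E) w j)"
    by (intro vnorm_cong) (simp add: mat_app_def adj_def algebra_simps sum_subtractf)
  also have "\<dots> \<le> vnorm J (mat_app I (adj M) w) + vnorm J (mat_app I (adj ?E) w)"
    by (rule vnorm_triangle_diff)
  also have "\<dots> \<le> 2 * e * vnorm I w"
    using 1 vnorm_adj_le[OF fin e e_small(1), of w] by simp
  also have "\<dots> \<le> 2 * e * vnorm I v" using w e_small by (intro mult_left_mono) auto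
  finally show ?thesis using g unfolding w_def by (simp add: field_simps)
qed

text \<open>Wedin's theorem for the left singular space. It suffices to combine the two one-sided
  estimates, since \<open>P - Q = P (I - Q) - (I - P) Q\<close>.\<close>

lemma projector_perturbation:
  assumes P: "is_orth_projector I (column_space I s X) P"
  shows "vnorm I (\<lambda>i. mat_app I P v i - mat_app I (leading_projector s U) v i)
    \<le> 4 * e / (a * b * m) * vnorm I v"
proof -
  let ?Q = "leading_projector s U"
  let ?u = "mat_app I P (\<lambda>i. v i - mat_app I ?Q v i)"
  let ?w = "\<lambda>i. mat_app I ?Q v i - mat_app I P (mat_app I ?Q v) i"
  have "vnorm I (\<lambda>i. mat_app I P v i - mat_app I ?Q v i) = vnorm I (\<lambda>i. ?u i - ?w i)"
    by (rule vnorm_cong) (simp add: mat_app_diff)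
  also have "\<dots> \<le> vnorm I ?u + vnorm I ?w"
    by (rule vnorm_triangle_diff)
  also have "\<dots> \<le> 2 * (2 * e / (a * b * m) * vnorm I v)"
    using leading_space_near_column_space[OF P, of v] column_space_near_leading_space[OF P, of v]
    by simp
  finally show ?thesis by simp
qed

end

section \<open>The smallest eigenvalue of a Gram matrix\<close>

lemma eigenvalue_gram_iff:
  "eigenvalue (gram I s V) l \<longleftrightarrow>
    (\<exists>c. (\<exists>j<s. c j \<noteq> 0) \<and> (\<forall>j<s. vinner I (\<lambda>i. V i j) (mat_app {..<s} V c) = l * c j))"
proof -
  have app: "(gram I s V *\<^sub>v v) $ j = vinner I (\<lambda>i. V i j) (mat_app {..<s} V (\<lambda>k. v $ k))"
    if "v \<in> carrier_vec s" "j < s" for v j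
  proof -
    have "(gram I s V *\<^sub>v v) $ j = (\<Sum>k<s. (\<Sum>i\<in>I. cnj (V i j) * V i k) * v $ k)"
      using that by (simp add: gram_def scalar_prod_def atLeast0LessThan)
    also have "\<dots> = vinner I (\<lambda>i. V i j) (mat_app {..<s} V (\<lambda>k. v $ k))"
      unfolding vinner_mat_app_right by (simp add: vinner_def mult.commute)
    finally show ?thesis .
  qed
  have dim: "dim_row (gram I s V) = s" "dim_col (gram I s V) = s" by (simp_all add: gram_def)
  show ?thesis
  proof
    assume "eigenvalue (gram I s V) l"
    then obtain v where v: "v \<in> carrier_vec s" "v \<noteq> 0\<^sub>v s" "gram I s V *\<^sub>v v = l \<cdot>\<^sub>v v"
      by (auto simp: eigenvalue_def eigenvector_def dim)
    have "\<exists>j<s. v $ j \<noteq> 0" using v(1,2) by (auto simp: Matrix.vec_eq_iff)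
    moreover have "vinner I (\<lambda>i. V i j) (mat_app {..<s} V (\<lambda>k. v $ k)) = l * v $ j" if "j < s" for j
      using app[OF v(1) that] v that by simp
    ultimately show "\<exists>c. (\<exists>j<s. c j \<noteq> 0) \<and> (\<forall>j<s. vinner I (\<lambda>i. V i j) (mat_app {..<s} V c) = l * c j)"
      by (intro exI[of _ "\<lambda>k. v $ k"]) blast
  next
    assume "\<exists>c. (\<exists>j<s. c j \<noteq> 0) \<and> (\<forall>j<s. vinner I (\<lambda>i. V i j) (mat_app {..<s} V c) = l * c j)"
    then obtain c where c: "\<exists>j<s. c j \<noteq> 0" "\<forall>j<s. vinner I (\<lambda>i. V i j) (mat_app {..<s} V c) = l * c j"
      by blast
    define v where "v = Matrix.vec s c"
    have v: "v \<in> carrier_vec s" by (simp add: v_def)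
    have "v \<noteq> 0\<^sub>v s" using c(1) by (auto simp: v_def Matrix.vec_eq_iff)
    moreover have "mat_app {..<s} V (\<lambda>k. v $ k) = mat_app {..<s} V c"
      by (auto simp: mat_app_def v_def)
    then have "gram I s V *\<^sub>v v = l \<cdot>\<^sub>v v"
      using app[OF v] c(2) by (intro eq_vecI) (auto simp: dim v_def)
    ultimately show "eigenvalue (gram I s V) l"
      using v by (auto simp: eigenvalue_def eigenvector_def dim)
  qed
qed

lemma vnorm_add_scaled_sq:
  "(vnorm I (\<lambda>i. u i + complex_of_real \<tau> * v i))\<^sup>2
    = (vnorm I u)\<^sup>2 + 2 * \<tau> * Re (vinner I v u) + \<tau>\<^sup>2 * (vnorm I v)\<^sup>2"
proof -
  have "(cmod (x + complex_of_real \<tau> * y))\<^sup>2 = (cmod x)\<^sup>2 + 2 * \<tau> * Re (cnj y * x) + \<tau>\<^sup>2 * (cmod y)\<^sup>2" for x y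
    unfolding cmod_power2 by (simp add: power2_eq_square algebra_simps)
  then show ?thesis
    by (simp add: vnorm_sq vinner_def sum.distrib sum_distrib_left mult.assoc distrib_left)
qed

lemma vinner_mat_app_left:
  "vinner I (mat_app K U z) u = (\<Sum>k\<in>K. cnj (z k) * vinner I (\<lambda>i. U i k) u)"
proof -
  have "vinner I (mat_app K U z) u = cnj (vinner I u (mat_app K U z))" by (simp add: vinner_cnj)
  also have "\<dots> = (\<Sum>k\<in>K. cnj (z k) * vinner I (\<lambda>i. U i k) u)"
    by (simp add: vinner_mat_app_right vinner_cnj)
  finally show ?thesis .
qed

lemma compact_unit_sphere_coordinates:
  "compact {c :: nat \<Rightarrow> complex. (\<forall>j\<ge>s. c j = 0) \<and> (vnorm {..<s} c)\<^sup>2 = 1}"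
proof -
  let ?S = "\<lambda>j. if j < s then cball 0 1 else {0 :: complex}"
  have "compact (PiE UNIV ?S)"
    unfolding compactin_euclidean_iff[symmetric] euclidean_product_topology[symmetric] compactin_PiE
    by auto
  moreover have "closed {c :: nat \<Rightarrow> complex. (vnorm {..<s} c)\<^sup>2 = 1}"
    unfolding vnorm_sq
    by (intro closed_Collect_eq continuous_intros continuous_on_product_coordinates)
  ultimately have "compact (PiE UNIV ?S \<inter> {c. (vnorm {..<s} c)\<^sup>2 = 1})"
    by (rule compact_Int_closed)
  also have "PiE UNIV ?S \<inter> {c. (vnorm {..<s} c)\<^sup>2 = 1}
      = {c. (\<forall>j\<ge>s. c j = 0) \<and> (vnorm {..<s} c)\<^sup>2 = 1}"
  proof -
    have le1: "cmod (c j) \<le> 1" if "(vnorm {..<s} c)\<^sup>2 = 1" "j < s" for c :: "nat \<Rightarrow> complex" and j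
    proof -
      have "vnorm {..<s} c = 1" using that(1) vnorm_nonneg[of "{..<s}" c] by (simp add: power2_eq_1_iff)
      then show ?thesis
        using member_le_L2_set[of "{..<s}" j "\<lambda>j. cmod (c j)"] that(2) by (simp add: vnorm_def)
    qed
    have Pi: "c \<in> PiE UNIV ?S \<longleftrightarrow> (\<forall>j<s. cmod (c j) \<le> 1) \<and> (\<forall>j\<ge>s. c j = 0)" for c
    proof -
      have "c j \<in> ?S j \<longleftrightarrow> (j < s \<longrightarrow> cmod (c j) \<le> 1) \<and> (s \<le> j \<longrightarrow> c j = 0)" for j
        by (cases "j < s") auto
      then show ?thesis by (simp only: PiE_iff) auto
    qed
    show ?thesis
    proof (rule Set.set_eqI)
      fix c
      show "c \<in> PiE UNIV ?S \<inter> {c. (vnorm {..<s} c)\<^sup>2 = 1}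
        \<longleftrightarrow> c \<in> {c. (\<forall>j\<ge>s. c j = 0) \<and> (vnorm {..<s} c)\<^sup>2 = 1}"
        unfolding Int_iff mem_Collect_eq Pi using le1[of c] by blast
    qed
  qed
  finally show ?thesis .
qed

text \<open>The Rayleigh quotient \<open>\<parallel>V c\<parallel>\<^sup>2 / \<parallel>c\<parallel>\<^sup>2\<close> attains its minimum \<open>l\<close> by compactness. The form
  \<open>\<parallel>V c\<parallel>\<^sup>2 - l \<parallel>c\<parallel>\<^sup>2\<close> is then nonnegative and vanishes at the minimizer, so its first variation
  there vanishes too; that is the eigenvalue equation.\<close>

lemma gram_minimal_eigenvalue:
  assumes s: "1 \<le> s"
  obtains l where "eigenvalue (gram I s V) (complex_of_real l)"
    "\<And>c. l * (vnorm {..<s} c)\<^sup>2 \<le> (vnorm I (mat_app {..<s} V c))\<^sup>2"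
proof -
  let ?f = "\<lambda>c. (vnorm I (mat_app {..<s} V c))\<^sup>2"
  let ?S = "{c :: nat \<Rightarrow> complex. (\<forall>j\<ge>s. c j = 0) \<and> (vnorm {..<s} c)\<^sup>2 = 1}"
  have cont: "continuous_on ?S ?f"
    unfolding vnorm_sq mat_app_def
    by (intro continuous_intros continuous_on_subset[OF continuous_on_product_coordinates]) auto
  define e0 :: "nat \<Rightarrow> complex" where "e0 = (\<lambda>j. of_bool (j = 0))"
  have "(vnorm {..<s} e0)\<^sup>2 = (\<Sum>j<s. if j = 0 then 1 else 0)"
    unfolding vnorm_sq by (intro sum.cong) (auto simp: e0_def)
  then have "e0 \<in> ?S" using s by (simp add: e0_def)
  then have ne: "?S \<noteq> {}" by blast
  obtain c0 where c0: "c0 \<in> ?S" "\<And>c. c \<in> ?S \<Longrightarrow> ?f c0 \<le> ?f c"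
    using continuous_attains_inf[OF compact_unit_sphere_coordinates ne cont] by blast
  define l where "l = ?f c0"
  have lower: "l * (vnorm {..<s} c)\<^sup>2 \<le> ?f c" for c
  proof (cases "vnorm {..<s} c = 0")
    case False
    let ?n = "vnorm {..<s} c"
    define c' where "c' = (\<lambda>j. if j < s then complex_of_real (1 / ?n) * c j else 0)"
    have n: "?n > 0" using False vnorm_nonneg[of "{..<s}" c] by linarith
    have "vnorm {..<s} c' = vnorm {..<s} (\<lambda>j. complex_of_real (1 / ?n) * c j)"
      by (rule vnorm_cong) (simp add: c'_def)
    also have "\<dots> = 1" unfolding vnorm_scale using n by (simp add: norm_divide)
    finally have "c' \<in> ?S" by (simp add: c'_def)
    then have "l \<le> ?f c'" unfolding l_def by (rule c0(2))
    also have "?f c' = ?f (\<lambda>j. complex_of_real (1 / ?n) * c j)"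
      by (intro arg_cong[where f = "\<lambda>x. x\<^sup>2"] vnorm_cong mat_app_cong) (simp add: c'_def)
    also have "\<dots> = ?f c / ?n\<^sup>2"
      using n unfolding mat_app_scale vnorm_scale by (simp add: norm_divide power_divide)
    finally show ?thesis using n by (simp add: field_simps)
  qed simp
  define g where "g = (\<lambda>j. vinner I (\<lambda>i. V i j) (mat_app {..<s} V c0))"
  define u where "u = (\<lambda>j. g j - complex_of_real l * c0 j)"
  have expand: "?f (\<lambda>j. c0 j + complex_of_real \<tau> * u j)
      = ?f c0 + 2 * \<tau> * Re (vinner {..<s} u g) + \<tau>\<^sup>2 * ?f u" for \<tau>
  proof -
    have "mat_app {..<s} V (\<lambda>j. c0 j + complex_of_real \<tau> * u j)
        = (\<lambda>i. mat_app {..<s} V c0 i + complex_of_real \<tau> * mat_app {..<s} V u i)"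
      by (simp add: mat_app_def fun_eq_iff algebra_simps sum.distrib sum_distrib_left)
    moreover have "vinner I (mat_app {..<s} V u) (mat_app {..<s} V c0) = vinner {..<s} u g"
      unfolding vinner_mat_app_left by (simp add: vinner_def[of "{..<s}"] g_def)
    ultimately show ?thesis by (simp add: vnorm_add_scaled_sq)
  qed
  have "Re (vinner {..<s} u g) - l * Re (vinner {..<s} u c0) = Re (vinner {..<s} u u)"
    by (simp add: u_def vinner_diff_right vinner_scale_right)
  then have ug: "Re (vinner {..<s} u g) = l * Re (vinner {..<s} u c0) + (vnorm {..<s} u)\<^sup>2"
    by (simp add: vinner_self)
  have c0n: "(vnorm {..<s} c0)\<^sup>2 = 1" using c0(1) by simp
  let ?y = "?f u - l * (vnorm {..<s} u)\<^sup>2"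
  have nonneg: "0 \<le> 2 * \<tau> * (vnorm {..<s} u)\<^sup>2 + \<tau>\<^sup>2 * ?y" for \<tau>
    using lower[of "\<lambda>j. c0 j + complex_of_real \<tau> * u j"]
    unfolding expand vnorm_add_scaled_sq ug c0n l_def[symmetric] by (simp add: algebra_simps)
  have "((\<lambda>\<tau>. 2 * \<tau> * (vnorm {..<s} u)\<^sup>2 + \<tau>\<^sup>2 * ?y) has_real_derivative 2 * (vnorm {..<s} u)\<^sup>2) (at 0)"
    by (auto intro!: derivative_eq_intros)
  then have "2 * (vnorm {..<s} u)\<^sup>2 = 0"
    by (rule DERIV_local_min[of _ _ _ 1]) (use nonneg in auto)
  then have "u j = 0" if "j < s" for j using that vnorm_zero_iff[of "{..<s}" u] by simp
  then have eig: "\<forall>j<s. vinner I (\<lambda>i. V i j) (mat_app {..<s} V c0) = complex_of_real l * c0 j"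
    by (simp add: u_def g_def)
  have "\<exists>j<s. c0 j \<noteq> 0"
  proof (rule ccontr)
    assume "\<not> (\<exists>j<s. c0 j \<noteq> 0)"
    then have "vnorm {..<s} c0 = 0" by (simp add: vnorm_zero_iff)
    then show False using c0n by simp
  qed
  then have "eigenvalue (gram I s V) (complex_of_real l)"
    using eig unfolding eigenvalue_gram_iff by blast
  then show thesis using lower that by blast
qed

lemma lambda_min_gram:
  assumes s: "1 \<le> s" and I: "finite I" and rank: "full_column_rank I s V"
  shows lambda_min_gram_pos: "0 < lambda_min (gram I s V)"
    and lambda_min_gram_le: "lambda_min (gram I s V) * (vnorm {..<s} c)\<^sup>2 \<le> (vnorm I (mat_app {..<s} V c))\<^sup>2"
proof -
  let ?L = "{l. eigenvalue (gram I s V) (complex_of_real l)}"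
  obtain l where l: "eigenvalue (gram I s V) (complex_of_real l)"
    "\<And>c. l * (vnorm {..<s} c)\<^sup>2 \<le> (vnorm I (mat_app {..<s} V c))\<^sup>2"
    using gram_minimal_eigenvalue[OF s, of I V] by blast
  have carrier: "gram I s V \<in> carrier_mat s s" by (simp add: gram_def)
  have "finite (complex_of_real -` spectrum (gram I s V))"
    by (rule finite_vimageI[OF card_finite_spectrum(1)[OF carrier]]) (simp add: inj_on_def)
  then have fin: "finite ?L" by (simp add: spectrum_def vimage_def)
  have "lambda_min (gram I s V) \<le> l" unfolding lambda_min_def using fin l(1) by simp
  then show "lambda_min (gram I s V) * (vnorm {..<s} c)\<^sup>2 \<le> (vnorm I (mat_app {..<s} V c))\<^sup>2"
    using l(2)[of c] by (meson mult_right_mono order_trans zero_le_power2)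
  have "lambda_min (gram I s V) \<in> ?L"
    unfolding lambda_min_def using fin l(1) by (intro Min_in) auto
  then obtain c where c: "\<exists>j<s. c j \<noteq> 0"
    "\<And>j. j < s \<Longrightarrow> vinner I (\<lambda>i. V i j) (mat_app {..<s} V c) = complex_of_real (lambda_min (gram I s V)) * c j"
    unfolding eigenvalue_gram_iff by blast
  have "complex_of_real ((vnorm I (mat_app {..<s} V c))\<^sup>2)
      = vinner {..<s} c (\<lambda>j. complex_of_real (lambda_min (gram I s V)) * c j)"
    unfolding vinner_self[symmetric] vinner_mat_app_left vinner_def[of "{..<s}"]
    by (intro sum.cong) (simp_all add: c(2))
  then have "(vnorm I (mat_app {..<s} V c))\<^sup>2 = lambda_min (gram I s V) * (vnorm {..<s} c)\<^sup>2"
    unfolding vinner_scale_right vinner_self of_real_mult[symmetric] of_real_eq_iff .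
  moreover have "0 < vnorm I (mat_app {..<s} V c)"
    using rank c(1) I unfolding full_column_rank_def by (metis vnorm_pos)
  ultimately have "0 < lambda_min (gram I s V) * (vnorm {..<s} c)\<^sup>2" by (metis zero_less_power)
  then show "0 < lambda_min (gram I s V)" by (simp add: zero_less_mult_iff)
qed

section \<open>Trigonometric polynomials and the stability of their nondegenerate zeros\<close>

definition trig :: "'k set \<Rightarrow> ('k \<Rightarrow> 'a::real_inner) \<Rightarrow> ('k \<Rightarrow> complex) \<Rightarrow> 'a \<Rightarrow> real" where
  "trig K w a p = (\<Sum>k\<in>K. Re (a k * cis (inner (w k) p)))"

text \<open>Derivatives are taken along a direction \<open>h\<close>, since only restrictions to lines occur below.\<close>

definition trig_grad :: "'k set \<Rightarrow> ('k \<Rightarrow> 'a::real_inner) \<Rightarrow> ('k \<Rightarrow> complex) \<Rightarrow> 'a \<Rightarrow> 'a \<Rightarrow> real" where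
  "trig_grad K w a p h = - (\<Sum>k\<in>K. inner (w k) h * Im (a k * cis (inner (w k) p)))"

definition trig_hess :: "'k set \<Rightarrow> ('k \<Rightarrow> 'a::real_inner) \<Rightarrow> ('k \<Rightarrow> complex) \<Rightarrow> 'a \<Rightarrow> 'a \<Rightarrow> real" where
  "trig_hess K w a p h = - (\<Sum>k\<in>K. (inner (w k) h)\<^sup>2 * Re (a k * cis (inner (w k) p)))"

lemma trig_has_derivative_along_line:
  "((\<lambda>\<tau>. trig K w a (p + \<tau> *\<^sub>R h)) has_real_derivative trig_grad K w a (p + \<tau> *\<^sub>R h) h) (at \<tau>)"
  unfolding trig_def trig_grad_def inner_add_right inner_scaleR_right sum_negf[symmetric]
  by (auto intro!: derivative_eq_intros sum.cong simp: algebra_simps)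

lemma trig_grad_has_derivative_along_line:
  "((\<lambda>\<tau>. trig_grad K w a (p + \<tau> *\<^sub>R h) h) has_real_derivative trig_hess K w a (p + \<tau> *\<^sub>R h) h) (at \<tau>)"
  unfolding trig_grad_def trig_hess_def inner_add_right inner_scaleR_right sum_negf[symmetric]
  by (auto intro!: derivative_eq_intros sum.cong simp: algebra_simps power2_eq_square)

lemma continuous_on_trig: "continuous_on S (trig K w a)"
  unfolding trig_def by (intro continuous_intros)

lemma cis_Lipschitz: "cmod (cis x - cis y) \<le> \<bar>x - y\<bar>"
proof -
  have "cis x - cis y = cis y * (cis (x - y) - 1)"
    by (simp add: algebra_simps cis_mult)
  then have "cmod (cis x - cis y) = cmod (exp (\<i> * of_real (x - y)) - 1)"
    by (simp add: norm_mult cis_conv_exp)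
  also have "\<dots> = 2 * \<bar>sin ((x - y) / 2)\<bar>" by (rule dist_exp_i_1)
  also have "\<dots> \<le> \<bar>x - y\<bar>" using abs_sin_x_le_abs_x[of "(x - y) / 2"] by simp
  finally show ?thesis .
qed

lemma trig_perturbation:
  assumes "\<And>k. k \<in> K \<Longrightarrow> cmod (a' k - a k) \<le> \<delta>"
  shows "\<bar>trig K w a' p - trig K w a p\<bar> \<le> real (card K) * \<delta>"
proof -
  have "trig K w a' p - trig K w a p = (\<Sum>k\<in>K. Re ((a' k - a k) * cis (inner (w k) p)))"
    unfolding trig_def sum_subtractf[symmetric] by (intro sum.cong) (simp_all add: algebra_simps)
  also have "\<bar>\<dots>\<bar> \<le> (\<Sum>k\<in>K. \<delta>)"
  proof (rule order_trans[OF sum_abs], rule sum_mono)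
    fix k assume k: "k \<in> K"
    show "\<bar>Re ((a' k - a k) * cis (inner (w k) p))\<bar> \<le> \<delta>"
      using assms[OF k] abs_Re_le_cmod[of "(a' k - a k) * cis (inner (w k) p)"]
      by (simp only: norm_mult norm_cis mult_1_right)
  qed
  finally show ?thesis by simp
qed

lemma trig_hess_perturbation:
  assumes "\<And>k. k \<in> K \<Longrightarrow> cmod (a' k - a k) \<le> \<delta>"
  shows "\<bar>trig_hess K w a' p h - trig_hess K w a t h\<bar>
    \<le> (\<delta> * (\<Sum>k\<in>K. (norm (w k))\<^sup>2) + norm (p - t) * (\<Sum>k\<in>K. cmod (a k) * norm (w k) ^ 3)) * (norm h)\<^sup>2"
proof -
  let ?D = "\<lambda>k. a' k * cis (inner (w k) p) - a k * cis (inner (w k) t)"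
  have "trig_hess K w a' p h - trig_hess K w a t h = - (\<Sum>k\<in>K. (inner (w k) h)\<^sup>2 * Re (?D k))"
    unfolding trig_hess_def minus_complex.sel right_diff_distrib sum_subtractf by (rule minus_diff_minus)
  also have "\<bar>\<dots>\<bar> \<le> (\<Sum>k\<in>K. (norm (w k))\<^sup>2 * (norm h)\<^sup>2 * (\<delta> + cmod (a k) * (norm (w k) * norm (p - t))))"
    unfolding abs_minus_cancel
  proof (rule order_trans[OF sum_abs], rule sum_mono)
    fix k assume k: "k \<in> K"
    have "?D k = (a' k - a k) * cis (inner (w k) p) + a k * (cis (inner (w k) p) - cis (inner (w k) t))"
      by (simp add: algebra_simps)
    then have "cmod (?D k) \<le> cmod (a' k - a k) + cmod (a k) * cmod (cis (inner (w k) p) - cis (inner (w k) t))"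
      by (metis mult.right_neutral norm_cis norm_mult norm_triangle_ineq)
    also have "\<dots> \<le> \<delta> + cmod (a k) * (norm (w k) * norm (p - t))"
    proof (intro add_mono mult_left_mono assms k)
      have "cmod (cis (inner (w k) p) - cis (inner (w k) t)) \<le> \<bar>inner (w k) (p - t)\<bar>"
        using cis_Lipschitz[of "inner (w k) p" "inner (w k) t"] by (simp add: inner_diff_right)
      also have "\<dots> \<le> norm (w k) * norm (p - t)" by (rule Cauchy_Schwarz_ineq2)
      finally show "cmod (cis (inner (w k) p) - cis (inner (w k) t)) \<le> norm (w k) * norm (p - t)" .
    qed simp
    finally have D: "\<bar>Re (?D k)\<bar> \<le> \<delta> + cmod (a k) * (norm (w k) * norm (p - t))"
      using abs_Re_le_cmod[of "?D k"] by linarith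
    have "(inner (w k) h)\<^sup>2 \<le> (norm (w k) * norm h)\<^sup>2"
      using Cauchy_Schwarz_ineq2[of "w k" h] by (rule power2_le_iff_abs_le[THEN iffD2, rotated]) simp
    then have "(inner (w k) h)\<^sup>2 \<le> (norm (w k))\<^sup>2 * (norm h)\<^sup>2" by (simp add: power_mult_distrib)
    then show "\<bar>(inner (w k) h)\<^sup>2 * Re (?D k)\<bar>
        \<le> (norm (w k))\<^sup>2 * (norm h)\<^sup>2 * (\<delta> + cmod (a k) * (norm (w k) * norm (p - t)))"
      using D unfolding abs_mult by (intro mult_mono) auto
  qed
  also have "\<dots> = (\<delta> * (\<Sum>k\<in>K. (norm (w k))\<^sup>2) + norm (p - t) * (\<Sum>k\<in>K. cmod (a k) * norm (w k) ^ 3)) * (norm h)\<^sup>2"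
    by (simp add: sum.distrib sum_distrib_left sum_distrib_right algebra_simps power2_eq_square power3_eq_cube)
  finally show ?thesis .
qed

text \<open>If \<open>g''(0) < 2\<kappa>\<close>, then \<open>g - \<kappa> \<tau>\<^sup>2\<close>, whose derivative vanishes at its minimum \<open>0\<close>, would
  decrease to the right of \<open>0\<close>.\<close>

lemma second_derivative_ge_of_quadratic_growth:
  fixes g g' :: "real \<Rightarrow> real"
  assumes g: "\<And>\<tau>. (g has_real_derivative g' \<tau>) (at \<tau>)" and g': "(g' has_real_derivative l) (at 0)"
    and \<rho>: "0 < \<rho>" and growth: "\<And>\<tau>. \<bar>\<tau>\<bar> < \<rho> \<Longrightarrow> \<kappa> * \<tau>\<^sup>2 \<le> g \<tau>" and g0: "g 0 = 0"
  shows "2 * \<kappa> \<le> l"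
proof (rule ccontr)
  assume "\<not> 2 * \<kappa> \<le> l"
  let ?G = "\<lambda>\<tau>. g \<tau> - \<kappa> * \<tau>\<^sup>2" and ?G' = "\<lambda>\<tau>. g' \<tau> - 2 * \<kappa> * \<tau>"
  have G: "(?G has_real_derivative ?G' \<tau>) (at \<tau>)" for \<tau>
    using g[of \<tau>] by (auto intro!: derivative_eq_intros)
  have G': "(?G' has_real_derivative (l - 2 * \<kappa>)) (at 0)"
    using g' by (auto intro!: derivative_eq_intros)
  have G'0: "?G' 0 = 0"
    by (rule DERIV_local_min[OF G \<rho>]) (use growth g0 in \<open>auto simp: abs_minus_commute\<close>)
  from DERIV_neg_dec_right[OF G'] \<open>\<not> 2 * \<kappa> \<le> l\<close> obtain d where
    d: "0 < d" "\<And>h. 0 < h \<Longrightarrow> h < d \<Longrightarrow> ?G' h < 0"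
    using G'0 by auto
  define x where "x = min d \<rho> / 2"
  have x: "0 < x" "x < d" "x < \<rho>" using d \<rho> by (auto simp: x_def)
  obtain z where z: "0 < z" "z < x" "?G x - ?G 0 = (x - 0) * ?G' z"
    using MVT2[OF x(1), of ?G ?G'] G by blast
  have "x * ?G' z < 0" using z x d(2)[of z] by (simp add: mult_pos_neg)
  moreover have "0 \<le> ?G x" using growth[of x] x by simp
  ultimately show False using z(3) g0 by simp
qed

lemma trig_hess_ge_at_nondegenerate_zero:
  assumes \<rho>: "0 < \<rho>" and zero: "trig K w a t = 0"
    and growth: "\<And>p. dist p t < \<rho> \<Longrightarrow> \<kappa> * (dist p t)\<^sup>2 \<le> trig K w a p"
  shows "2 * \<kappa> * (norm h)\<^sup>2 \<le> trig_hess K w a t h"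
proof -
  let ?g = "\<lambda>\<tau>. trig K w a (t + \<tau> *\<^sub>R h)"
  have "2 * (\<kappa> * (norm h)\<^sup>2) \<le> trig_hess K w a (t + 0 *\<^sub>R h) h"
  proof (rule second_derivative_ge_of_quadratic_growth[of ?g])
    show "(?g has_real_derivative trig_grad K w a (t + \<tau> *\<^sub>R h) h) (at \<tau>)" for \<tau>
      by (rule trig_has_derivative_along_line)
    show "((\<lambda>\<tau>. trig_grad K w a (t + \<tau> *\<^sub>R h) h) has_real_derivative
        trig_hess K w a (t + 0 *\<^sub>R h) h) (at 0)"
      by (rule trig_grad_has_derivative_along_line)
    show "0 < \<rho> / (norm h + 1)" using \<rho> by (simp add: add_nonneg_pos)
    show "\<kappa> * (norm h)\<^sup>2 * \<tau>\<^sup>2 \<le> ?g \<tau>" if "\<bar>\<tau>\<bar> < \<rho> / (norm h + 1)" for \<tau>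
    proof -
      have "norm h + 1 > 0" by (simp add: add_nonneg_pos)
      then have "\<bar>\<tau>\<bar> * (norm h + 1) < \<rho>" using that by (simp add: field_simps)
      then have "\<bar>\<tau>\<bar> * norm h < \<rho>" by (simp add: algebra_simps)
      then show ?thesis using growth[of "t + \<tau> *\<^sub>R h"] by (simp add: dist_norm power_mult_distrib mult_ac)
    qed
    show "?g 0 = 0" using zero by simp
  qed
  then show ?thesis by simp
qed

lemma trig_grad_local_min:
  assumes "local_min_on (trig K w a) F p" "p \<in> S" "open S" "S \<subseteq> F"
  shows "trig_grad K w a p h = 0"
proof -
  from assms(1) obtain d where d: "0 < d" "\<And>y. y \<in> F \<Longrightarrow> y \<noteq> p \<Longrightarrow> dist y p < d \<Longrightarrow> trig K w a p \<le> trig K w a y"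
    unfolding local_min_on_def eventually_at by auto
  obtain d' where d': "0 < d'" "ball p d' \<subseteq> S"
    using assms(2,3) by (auto simp: open_contains_ball)
  let ?e = "min d d' / (norm h + 1)"
  have h: "norm h + 1 > 0" by (simp add: add_nonneg_pos)
  have "trig_grad K w a (p + 0 *\<^sub>R h) h = 0"
  proof (rule DERIV_local_min[OF trig_has_derivative_along_line])
    show "0 < ?e" using d d' h by simp
    show "\<forall>y. \<bar>0 - y\<bar> < ?e \<longrightarrow> trig K w a (p + 0 *\<^sub>R h) \<le> trig K w a (p + y *\<^sub>R h)"
    proof (intro allI impI)
      fix y :: real assume "\<bar>0 - y\<bar> < ?e"
      then have "\<bar>y\<bar> * (norm h + 1) < min d d'" using h by (simp add: pos_less_divide_eq)
      moreover have "\<bar>y\<bar> * norm h \<le> \<bar>y\<bar> * (norm h + 1)" by (intro mult_left_mono) auto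
      ultimately have "\<bar>y\<bar> * norm h < min d d'" by linarith
      then have dist: "dist (p + y *\<^sub>R h) p < min d d'" by (simp add: dist_norm)
      then have "p + y *\<^sub>R h \<in> F" using d'(2) assms(4) by (auto simp: dist_commute)
      with dist show "trig K w a (p + 0 *\<^sub>R h) \<le> trig K w a (p + y *\<^sub>R h)"
        using d(2)[of "p + y *\<^sub>R h"] by (cases "y *\<^sub>R h = 0") auto
    qed
  qed
  then show ?thesis by simp
qed

text \<open>The derivative along the segment joining two minimizers vanishes at both ends, so by the mean
  value theorem its own derivative vanishes in between, against the positivity of the Hessian.\<close>

lemma trig_local_min_unique:
  assumes "local_min_on (trig K w a) F p" "local_min_on (trig K w a) F p'"
    and ball: "p \<in> ball t r" "p' \<in> ball t r" "ball t r \<subseteq> F"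
    and hess: "\<And>y h. y \<in> ball t r \<Longrightarrow> h \<noteq> 0 \<Longrightarrow> 0 < trig_hess K w a y h"
  shows "p = p'"
proof (rule ccontr)
  assume "p \<noteq> p'"
  let ?h = "p' - p"
  let ?g' = "\<lambda>\<tau>. trig_grad K w a (p + \<tau> *\<^sub>R ?h) ?h"
  obtain z where z: "0 < z" "z < 1" "?g' 1 - ?g' 0 = (1 - 0) * trig_hess K w a (p + z *\<^sub>R ?h) ?h"
    using MVT2[of 0 1 ?g' "\<lambda>\<tau>. trig_hess K w a (p + \<tau> *\<^sub>R ?h) ?h"]
      trig_grad_has_derivative_along_line[of K w a p ?h] by auto
  have "?g' 0 = 0" "?g' 1 = 0"
    using trig_grad_local_min[OF assms(1) ball(1) open_ball ball(3)]
      trig_grad_local_min[OF assms(2) ball(2) open_ball ball(3)] by auto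
  then have "trig_hess K w a (p + z *\<^sub>R ?h) ?h = 0" using z(3) by simp
  moreover have "(1 - z) *\<^sub>R p + z *\<^sub>R p' \<in> ball t r"
    using convex_ball[of t r] ball z unfolding convex_alt by auto
  then have "p + z *\<^sub>R ?h \<in> ball t r" by (simp add: algebra_simps)
  ultimately show False using hess[of "p + z *\<^sub>R ?h" ?h] \<open>p \<noteq> p'\<close> by simp
qed

text \<open>A level \<open>m\<close> that strictly separates \<open>s\<close> local minimizers from all others leaves no choice,
  whatever ties there are above it.\<close>

lemma smallest_local_minima_iff:
  assumes "finite M\<^sub>0" "card M\<^sub>0 = s"
    and low: "\<And>p. p \<in> M\<^sub>0 \<Longrightarrow> local_min_on f F p \<and> f p < m"
    and high: "\<And>p. local_min_on f F p \<Longrightarrow> p \<notin> M\<^sub>0 \<Longrightarrow> m \<le> f p"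
  shows "smallest_local_minima f F s M \<longleftrightarrow> M = M\<^sub>0"
proof
  assume M: "smallest_local_minima f F s M"
  show "M = M\<^sub>0"
  proof (rule ccontr)
    assume ne: "M \<noteq> M\<^sub>0"
    have fin: "finite M" "card M = card M\<^sub>0" using M assms by (auto simp: smallest_local_minima_def)
    have "\<not> M \<subseteq> M\<^sub>0" "\<not> M\<^sub>0 \<subseteq> M"
      using ne fin assms(1) card_subset_eq by metis+
    then obtain p p' where p: "p \<in> M" "p \<notin> M\<^sub>0" "p' \<in> M\<^sub>0" "p' \<notin> M" by blast
    then have "f p \<le> f p'" using M low by (auto simp: smallest_local_minima_def)
    moreover have "m \<le> f p" using high p M by (auto simp: smallest_local_minima_def)
    ultimately show False using low[OF p(3)] by simp
  qed
next
  assume "M = M\<^sub>0"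
  then show "smallest_local_minima f F s M"
    using assms unfolding smallest_local_minima_def by force
qed

text \<open>The radius \<open>r\<close> is chosen so small that the Hessian varies by at most \<open>\<kappa> / 2\<close> within a ball, and
  \<open>\<delta>\<close> so small that the change of the coefficients costs at most another \<open>\<kappa> / 2\<close>; of the
  Hessian bound \<open>2 \<kappa>\<close> at the zeros, at least \<open>\<kappa>\<close> remains. With \<open>m\<close> a lower bound for the
  polynomial off the balls, \<open>\<delta>\<close> also limits the change of values to \<open>m / 3\<close>, so that the level
  \<open>m / 2\<close> separates the minima in the balls from everything outside.\<close>

lemma trig_minima_stable:
  fixes w :: "'k \<Rightarrow> 'a::euclidean_space"
  assumes K: "finite K" and F: "compact F" and T: "finite T" "T \<subseteq> interior F"
    and \<kappa>: "0 < \<kappa>" and \<rho>: "0 < \<rho>" and sep: "\<And>t t'. t \<in> T \<Longrightarrow> t' \<in> T \<Longrightarrow> t \<noteq> t' \<Longrightarrow> 2 * \<rho> \<le> dist t t'"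
    and zero: "\<And>t. t \<in> T \<Longrightarrow> trig K w a t = 0"
    and posF: "\<And>p. p \<in> F \<Longrightarrow> p \<notin> T \<Longrightarrow> 0 < trig K w a p"
    and growth: "\<And>t p. t \<in> T \<Longrightarrow> p \<in> F \<Longrightarrow> dist p t < \<rho> \<Longrightarrow> \<kappa> * (dist p t)\<^sup>2 \<le> trig K w a p"
  shows "\<exists>\<delta>>0. \<forall>a'. (\<forall>k\<in>K. cmod (a' k - a k) \<le> \<delta>) \<longrightarrow>
    (\<exists>th. inj_on th T \<and>
      (\<forall>t\<in>T. th t \<in> F \<and> dist (th t) t < \<rho> \<and> trig K w a' (th t) \<le> trig K w a' t) \<and>
      (\<forall>M. smallest_local_minima (trig K w a') F (card T) M \<longleftrightarrow> M = th ` T))"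
proof -
  define W2 where "W2 = (\<Sum>k\<in>K. (norm (w k))\<^sup>2)"
  define W3 where "W3 = (\<Sum>k\<in>K. cmod (a k) * norm (w k) ^ 3)"
  have W: "0 \<le> W2" "0 \<le> W3" unfolding W2_def W3_def by (auto intro!: sum_nonneg)
  have "\<forall>t\<in>T. \<exists>e>0. cball t e \<subseteq> F"
    using T(2) by (auto simp: mem_interior_cball)
  then obtain e where e: "\<And>t. t \<in> T \<Longrightarrow> 0 < e t" "\<And>t. t \<in> T \<Longrightarrow> cball t (e t) \<subseteq> F" by metis
  define e0 where "e0 = Min (insert 1 (e ` T))"
  have e0: "0 < e0" "\<And>t. t \<in> T \<Longrightarrow> e0 \<le> e t" using e T(1) by (auto simp: e0_def)
  define r where "r = min e0 (min \<rho> (\<kappa> / (2 * (W3 + 1))))"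
  have r: "0 < r" "r \<le> \<rho>" using e0 \<rho> \<kappa> W by (auto simp: r_def)
  have rF: "cball t r \<subseteq> F" if "t \<in> T" for t
    using e(2)[OF that] e0(2)[OF that] by (auto simp: r_def)
  have rW: "r * W3 \<le> \<kappa> / 2"
  proof -
    have "r * W3 \<le> \<kappa> / (2 * (W3 + 1)) * (W3 + 1)"
      using W \<kappa> r by (intro mult_mono) (auto simp: r_def)
    also have "\<dots> = \<kappa> / 2" using W by (simp add: field_simps)
    finally show ?thesis .
  qed
  let ?F' = "F - (\<Union>t\<in>T. ball t r)"
  \<comment> \<open>Away from the zeros the polynomial is bounded below; if the balls cover everything, any
    bound will do.\<close>
  have "\<exists>m>0. \<forall>p\<in>?F'. m \<le> trig K w a p"
  proof (cases "?F' = {}")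
    case False
    have "compact ?F'" by (intro compact_diff F open_UN ballI open_ball)
    then obtain p where p: "p \<in> ?F'" "\<forall>y\<in>?F'. trig K w a p \<le> trig K w a y"
      using continuous_attains_inf[OF _ False continuous_on_trig] by blast
    moreover have "p \<notin> T" using p(1) r(1) centre_in_ball by blast
    then have "0 < trig K w a p" using posF[of p] p(1) by blast
    ultimately show ?thesis by blast
  qed (auto intro: exI[of _ 1])
  then obtain m where m: "0 < m" "\<And>p. p \<in> ?F' \<Longrightarrow> m \<le> trig K w a p" by blast
  define \<delta> where "\<delta> = min (m / (3 * (real (card K) + 1))) (\<kappa> / (2 * (W2 + 1)))"
  have \<delta>: "0 < \<delta>" using m \<kappa> W by (auto simp: \<delta>_def)
  have \<delta>K: "real (card K) * \<delta> \<le> m / 3"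
  proof -
    have "real (card K) * \<delta> \<le> (real (card K) + 1) * (m / (3 * (real (card K) + 1)))"
      using \<delta> by (intro mult_mono) (auto simp: \<delta>_def)
    also have "\<dots> = m / 3" by (simp add: field_simps)
    finally show ?thesis .
  qed
  have \<delta>W: "\<delta> * W2 \<le> \<kappa> / 2"
  proof -
    have "\<delta> * W2 \<le> \<kappa> / (2 * (W2 + 1)) * (W2 + 1)"
      using W \<kappa> \<delta> by (intro mult_mono) (auto simp: \<delta>_def)
    also have "\<dots> = \<kappa> / 2" using W by (simp add: field_simps)
    finally show ?thesis .
  qed
  have "\<exists>th. inj_on th T \<and>
      (\<forall>t\<in>T. th t \<in> F \<and> dist (th t) t < \<rho> \<and> trig K w a' (th t) \<le> trig K w a' t) \<and>
      (\<forall>M. smallest_local_minima (trig K w a') F (card T) M \<longleftrightarrow> M = th ` T)"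
    if a': "\<forall>k\<in>K. cmod (a' k - a k) \<le> \<delta>" for a'
  proof -
    let ?f = "trig K w a'"
    have close: "\<bar>?f p - trig K w a p\<bar> \<le> m / 3" for p
      using trig_perturbation[of K a' a \<delta> w p] a' \<delta>K by force
    have low: "?f t < m / 2" if "t \<in> T" for t
      using close[of t] zero[OF that] m(1) by simp
    have high: "m / 2 \<le> ?f p" if "p \<in> ?F'" for p
      using close[of p] m(2)[OF that] m(1) by linarith
    have hess: "0 < trig_hess K w a' y h" if "t \<in> T" "y \<in> ball t r" "h \<noteq> 0" for t y h
    proof -
      have h: "0 < (norm h)\<^sup>2" using that by simp
      have "2 * \<kappa> * (norm h)\<^sup>2 \<le> trig_hess K w a t h"
      proof (rule trig_hess_ge_at_nondegenerate_zero[OF r(1) zero[OF that(1)]])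
        fix p assume "dist p t < r"
        then show "\<kappa> * (dist p t)\<^sup>2 \<le> trig K w a p"
          using rF[OF that(1)] r(2) by (intro growth that(1)) (auto simp: dist_commute)
      qed
      moreover have "\<bar>trig_hess K w a' y h - trig_hess K w a t h\<bar> \<le> (\<delta> * W2 + norm (y - t) * W3) * (norm h)\<^sup>2"
        unfolding W2_def W3_def using a' by (intro trig_hess_perturbation) auto
      moreover have "(\<delta> * W2 + norm (y - t) * W3) * (norm h)\<^sup>2 \<le> \<kappa> * (norm h)\<^sup>2"
      proof (rule mult_right_mono)
        have "norm (y - t) * W3 \<le> r * W3"
          using that(2) W by (intro mult_right_mono) (auto simp: dist_norm norm_minus_commute)
        then show "\<delta> * W2 + norm (y - t) * W3 \<le> \<kappa>" using rW \<delta>W by linarith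
      qed simp
      ultimately have "\<kappa> * (norm h)\<^sup>2 \<le> trig_hess K w a' y h" by linarith
      then show ?thesis using mult_pos_pos[OF \<kappa> h] by linarith
    qed
    have ex: "\<exists>p. local_min_on ?f F p \<and> dist p t < r \<and> ?f p \<le> ?f t" if t: "t \<in> T" for t
    proof -
      obtain p where p: "p \<in> cball t r" "\<And>y. y \<in> cball t r \<Longrightarrow> ?f p \<le> ?f y"
        using continuous_attains_inf[OF compact_cball _ continuous_on_trig, of t r K w a'] r(1) by auto
      have pt: "?f p \<le> ?f t" using p(2)[of t] r(1) by simp
      have pr: "dist p t < r"
      proof (rule ccontr)
        assume "\<not> dist p t < r"
        then have d: "dist p t = r" using p(1) by (simp add: dist_commute)
        have "p \<notin> ball t' r" if "t' \<in> T" for t'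
        proof (cases "t' = t")
          case False
          then show ?thesis using sep[OF t that] d dist_triangle[of t t' p] r
            by (simp add: dist_commute)
        qed (use d in \<open>simp add: dist_commute\<close>)
        then have "p \<in> ?F'" using p(1) rF[OF t] by auto
        then show False using high[of p] low[OF t] pt by simp
      qed
      have "local_min_on ?f F p"
        unfolding local_min_on_def eventually_at
      proof (intro conjI exI[of _ "r - dist p t"] ballI impI)
        show "p \<in> F" using p(1) rF[OF t] by blast
        fix y assume "y \<noteq> p \<and> dist y p < r - dist p t"
        then have "dist y t \<le> r" using dist_triangle[of y t p] by simp
        then show "?f p \<le> ?f y" using p(2) by (simp add: dist_commute)
      qed (use pr in simp)
      then show ?thesis using pt pr by blast
    qed
    then obtain th where th: "\<And>t. t \<in> T \<Longrightarrow> local_min_on ?f F (th t)"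
        "\<And>t. t \<in> T \<Longrightarrow> dist (th t) t < r" "\<And>t. t \<in> T \<Longrightarrow> ?f (th t) \<le> ?f t" by metis
    have inj: "inj_on th T"
    proof (rule inj_onI, rule ccontr)
      fix t t' assume t: "t \<in> T" "t' \<in> T" "th t = th t'" "t \<noteq> t'"
      have "dist t t' \<le> dist (th t) t + dist (th t') t'"
        unfolding t(3) using dist_triangle[of t t' "th t'"] by (simp add: dist_commute)
      then show False using sep[OF t(1,2,4)] th(2)[OF t(1)] th(2)[OF t(2)] r by linarith
    qed
    have "smallest_local_minima ?f F (card T) M \<longleftrightarrow> M = th ` T" for M
    proof (rule smallest_local_minima_iff)
      show "finite (th ` T)" using T by simp
      show "card (th ` T) = card T" using inj by (rule card_image)
      show "local_min_on ?f F p \<and> ?f p < m / 2" if "p \<in> th ` T" for p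
        using that th low by fastforce
      fix p assume p: "local_min_on ?f F p" "p \<notin> th ` T"
      have "p \<notin> ball t r" if t: "t \<in> T" for t
      proof
        assume "p \<in> ball t r"
        moreover have "th t \<in> ball t r" using th(2)[OF t] by (simp add: dist_commute)
        ultimately have "p = th t"
          using trig_local_min_unique[OF p(1) th(1)[OF t] _ _ _ hess[OF t]] rF[OF t] ball_subset_cball[of t r]
          by blast
        then show False using p(2) t by blast
      qed
      then have "p \<in> ?F'" using p(1) by (auto simp: local_min_on_def)
      then show "m / 2 \<le> ?f p" by (rule high)
    qed
    moreover have "\<forall>t\<in>T. th t \<in> F \<and> dist (th t) t < \<rho> \<and> ?f (th t) \<le> ?f t"
      using th r by (fastforce simp: local_min_on_def)
    ultimately show ?thesis using inj by blast
  qed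
  then show ?thesis using \<delta> by blast
qed

section \<open>The periodic distance\<close>

lemma INF_shift_le_sq: "(INF m::int. \<bar>x - 2 * pi * of_int m / \<omega>\<bar>\<^sup>2) \<le> x\<^sup>2"
  by (rule cINF_lower2[where x = 0]) (auto intro!: bdd_belowI2[of _ 0])

lemma INF_shift_ge:
  assumes \<omega>: "0 < \<omega>" and x: "\<bar>x\<bar> \<le> L" "L < 2 * pi / \<omega>"
  shows "(min \<bar>x\<bar> (2 * pi / \<omega> - L))\<^sup>2 \<le> (INF m::int. \<bar>x - 2 * pi * of_int m / \<omega>\<bar>\<^sup>2)"
proof (rule cINF_greatest)
  fix m :: int
  show "(min \<bar>x\<bar> (2 * pi / \<omega> - L))\<^sup>2 \<le> \<bar>x - 2 * pi * of_int m / \<omega>\<bar>\<^sup>2"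
  proof (rule power_mono)
    show "min \<bar>x\<bar> (2 * pi / \<omega> - L) \<le> \<bar>x - 2 * pi * of_int m / \<omega>\<bar>"
    proof (cases "m = 0")
      case False
      let ?P = "2 * pi / \<omega>"
      have P: "0 < ?P" using \<omega> by simp
      have "1 \<le> \<bar>real_of_int m\<bar>" using False by linarith
      then have "?P * 1 \<le> ?P * \<bar>real_of_int m\<bar>" using P by (intro mult_left_mono) auto
      also have "\<dots> = \<bar>2 * pi * of_int m / \<omega>\<bar>" using \<omega> by (simp add: abs_mult abs_divide)
      finally show ?thesis using x by linarith
    qed simp
  qed (use x in simp)
qed simp

lemma d_per_le_dist: "d_per q p p' \<le> dist p p'"
  unfolding d_per_def dist_prod_def dist_real_def power2_abs
  by (intro real_sqrt_le_mono add_mono) (use INF_shift_le_sq in simp_all)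

text \<open>Within the field of view a periodic image can only be closer than the point itself at
  distances of at least the gap between a period and the side length.\<close>

lemma d_per_eq_dist:
  assumes q: "0 < fst q" "0 < snd q"
    and x: "\<bar>fst p - fst p'\<bar> \<le> L1" "L1 < 2 * pi / fst q"
    and y: "\<bar>snd p - snd p'\<bar> \<le> L2" "L2 < 2 * pi / snd q"
    and \<rho>: "\<rho> \<le> 2 * pi / fst q - L1" "\<rho> \<le> 2 * pi / snd q - L2"
    and near: "d_per q p p' < \<rho>"
  shows "d_per q p p' = dist p p'"
proof -
  let ?x = "\<bar>fst p - fst p'\<bar>" and ?y = "\<bar>snd p - snd p'\<bar>"
  let ?mx = "min ?x (2 * pi / fst q - L1)" and ?my = "min ?y (2 * pi / snd q - L2)"
  have d: "sqrt (?mx\<^sup>2 + ?my\<^sup>2) \<le> d_per q p p'"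
    unfolding d_per_def using INF_shift_ge[OF q(1) x] INF_shift_ge[OF q(2) y]
    by (intro real_sqrt_le_mono add_mono)
  have "?mx \<le> sqrt (?mx\<^sup>2 + ?my\<^sup>2)" "?my \<le> sqrt (?mx\<^sup>2 + ?my\<^sup>2)"
    by (auto intro!: real_le_rsqrt)
  with d near \<rho> have "?mx = ?x" "?my = ?y" by linarith+
  then have "dist p p' \<le> d_per q p p'" using d by (simp add: dist_prod_def dist_real_def)
  then show ?thesis using d_per_le_dist[of q p p'] by simp
qed

section \<open>The squared residual is a trigonometric polynomial\<close>

definition freq :: "real \<times> real \<Rightarrow> int \<times> int \<Rightarrow> real \<times> real" where
  "freq q \<alpha> = (of_int (fst \<alpha>) * fst q, of_int (snd \<alpha>) * snd q)"

lemma steering_eq_cis: "steering q p \<alpha> = cis (inner (- freq q \<alpha>) p)"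
  by (simp add: steering_def freq_def cis_conv_exp inner_prod_def algebra_simps)

lemma cnj_steering_eq_cis: "cnj (steering q p \<alpha>) = cis (inner (freq q \<alpha>) p)"
  by (simp add: steering_eq_cis cis_cnj)

abbreviation residual_index ::
  "'i set \<Rightarrow> 'j set \<Rightarrow> ('i \<times> 'i + 'j \<times> 'j) set" where
  "residual_index A B \<equiv> (A \<times> A) <+> (B \<times> B)"

text \<open>The squared norm of \<open>v - P v\<close> is a quadratic form in \<open>v\<close>. For a steering vector the term
  with index \<open>(\<alpha>, \<alpha>')\<close> oscillates with the difference of two frequencies; its sign is opposite
  for \<open>B\<close>, where the steering vector is conjugated.\<close>

primrec residual_freq ::
  "real \<times> real \<Rightarrow> ((int \<times> int) \<times> (int \<times> int)) + ((int \<times> int) \<times> (int \<times> int)) \<Rightarrow> real \<times> real" where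
  "residual_freq q (Inl k) = freq q (fst k) - freq q (snd k)"
| "residual_freq q (Inr k) = freq q (snd k) - freq q (fst k)"

primrec residual_coeff ::
  "'i set \<Rightarrow> 'j set \<Rightarrow> ('i \<Rightarrow> 'i \<Rightarrow> complex) \<Rightarrow> ('j \<Rightarrow> 'j \<Rightarrow> complex)
    \<Rightarrow> ('i \<times> 'i) + ('j \<times> 'j) \<Rightarrow> complex" where
  "residual_coeff A B P Q (Inl k) = (of_bool (fst k = snd k) - P (fst k) (snd k)) / of_nat (card A)"
| "residual_coeff A B P Q (Inr k) = (of_bool (fst k = snd k) - Q (fst k) (snd k)) / of_nat (card B)"

lemma projector_residual_expansion:
  assumes "finite I" "is_orth_projector I W P"
  shows "(vnorm I (\<lambda>i. v i - mat_app I P v i))\<^sup>2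
    = (\<Sum>k\<in>I \<times> I. Re ((of_bool (fst k = snd k) - P (fst k) (snd k)) * (cnj (v (fst k)) * v (snd k))))"
proof -
  have "complex_of_real ((vnorm I (\<lambda>i. v i - mat_app I P v i))\<^sup>2)
      = (\<Sum>i\<in>I. cnj (v i) * (v i - mat_app I P v i))"
    unfolding projector_residual_sq[OF assms(2)] vinner_def ..
  also have "\<dots> = (\<Sum>i\<in>I. \<Sum>k\<in>I. (of_bool (i = k) - P i k) * (cnj (v i) * v k))"
  proof (rule sum.cong[OF refl])
    fix i assume "i \<in> I"
    have "(\<Sum>k\<in>I. of_bool (i = k) * (cnj (v i) * v k)) = (\<Sum>k\<in>I. if k = i then cnj (v i) * v i else 0)"
      by (intro sum.cong) auto
    also have "\<dots> = cnj (v i) * v i" using assms(1) \<open>i \<in> I\<close> by simp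
    finally show "cnj (v i) * (v i - mat_app I P v i)
        = (\<Sum>k\<in>I. (of_bool (i = k) - P i k) * (cnj (v i) * v k))"
      by (simp add: left_diff_distrib sum_subtractf mat_app_def right_diff_distrib sum_distrib_left mult_ac)
  qed
  also have "\<dots> = (\<Sum>k\<in>I \<times> I. (of_bool (fst k = snd k) - P (fst k) (snd k)) * (cnj (v (fst k)) * v (snd k)))"
    by (simp add: sum.cartesian_product case_prod_beta)
  finally show ?thesis by (metis Re_complex_of_real Re_sum)
qed

lemma residual_eq_sqrt_trig:
  assumes fin: "finite A" "finite B"
    and P: "is_orth_projector A W P" and Q: "is_orth_projector B W' Q"
  shows "residual A B q P Q p
    = sqrt (trig (residual_index A B) (residual_freq q) (residual_coeff A B P Q) p)"
proof -
  let ?v = "steering q p" and ?w = "\<lambda>\<beta>. cnj (steering q p \<beta>)"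
  have c: "cis x * cis y = cis z" if "x + y = z" for x y z using that by (simp add: cis_mult)
  have v: "cnj (?v \<alpha>) * ?v \<alpha>' = cis (inner (freq q \<alpha> - freq q \<alpha>') p)" for \<alpha> \<alpha>'
    by (subst cnj_steering_eq_cis, subst steering_eq_cis, rule c) (simp add: inner_diff_left)
  have w: "cnj (?w \<alpha>) * ?w \<alpha>' = cis (inner (freq q \<alpha>' - freq q \<alpha>) p)" for \<alpha> \<alpha>'
    unfolding complex_cnj_cnj
    by (subst cnj_steering_eq_cis, subst steering_eq_cis, rule c) (simp add: inner_diff_left)
  have "(vnorm A (\<lambda>\<alpha>. ?v \<alpha> - mat_app A P ?v \<alpha>))\<^sup>2 / real (card A)
      = (\<Sum>k\<in>A \<times> A. Re (residual_coeff A B P Q (Inl k) * cis (inner (residual_freq q (Inl k)) p)))"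
    unfolding projector_residual_expansion[OF fin(1) P] v
    by (simp add: sum_divide_distrib Re_divide_of_nat del: times_complex.sel)
  moreover have "(vnorm B (\<lambda>\<beta>. ?w \<beta> - mat_app B Q ?w \<beta>))\<^sup>2 / real (card B)
      = (\<Sum>k\<in>B \<times> B. Re (residual_coeff A B P Q (Inr k) * cis (inner (residual_freq q (Inr k)) p)))"
    unfolding projector_residual_expansion[OF fin(2) Q] w
    by (simp add: sum_divide_distrib Re_divide_of_nat del: times_complex.sel)
  ultimately show ?thesis
    using fin by (simp add: residual_def Let_def trig_def sum.Plus del: residual_coeff.simps residual_freq.simps)
qed

text \<open>An entry of a matrix is bounded by its operator norm.\<close>

lemma residual_coeff_close:
  assumes fin: "finite A" "finite B"
    and P: "\<And>v. vnorm A (\<lambda>i. mat_app A P v i - mat_app A P' v i) \<le> \<eta> * vnorm A v"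
    and Q: "\<And>v. vnorm B (\<lambda>i. mat_app B Q v i - mat_app B Q' v i) \<le> \<eta> * vnorm B v"
    and k: "k \<in> residual_index A B"
  shows "cmod (residual_coeff A B P' Q' k - residual_coeff A B P Q k) \<le> \<eta>"
proof -
  have entry: "cmod (R i j - R' i j) / real (card I) \<le> \<eta>"
    if I: "finite I" "i \<in> I" "j \<in> I"
      and R: "\<And>v. vnorm I (\<lambda>i. mat_app I R v i - mat_app I R' v i) \<le> \<eta> * vnorm I v"
    for I :: "'x set" and i j R R'
  proof -
    let ?e = "\<lambda>k. of_bool (k = j) :: complex"
    have e: "mat_app I S ?e i = S i j" for S
    proof -
      have "mat_app I S ?e i = (\<Sum>k\<in>I. if k = j then S i j else 0)"
        unfolding mat_app_def by (intro sum.cong) auto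
      then show ?thesis using I by simp
    qed
    have "(vnorm I ?e)\<^sup>2 = (\<Sum>k\<in>I. if k = j then 1 else 0)"
      unfolding vnorm_sq by (intro sum.cong) auto
    then have "vnorm I ?e = 1"
      using I vnorm_nonneg[of I ?e] by (simp add: power2_eq_1_iff)
    then have "vnorm I (\<lambda>i. mat_app I R ?e i - mat_app I R' ?e i) \<le> \<eta>" using R[of ?e] by simp
    moreover have "cmod (R i j - R' i j) \<le> vnorm I (\<lambda>i. mat_app I R ?e i - mat_app I R' ?e i)"
      unfolding e[symmetric] vnorm_def
      using member_le_L2_set[OF I(1,2), of "\<lambda>i. cmod (mat_app I R ?e i - mat_app I R' ?e i)"] by simp
    moreover have "1 \<le> card I" using I by (simp add: Suc_le_eq card_gt_0_iff) blast
    then have "cmod (R i j - R' i j) / real (card I) \<le> cmod (R i j - R' i j)"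
      by (simp add: divide_le_eq mult_le_cancel_left1)
    ultimately show ?thesis by linarith
  qed
  have diff: "cmod ((x - y') / of_nat n - (x - y) / of_nat n) = cmod (y - y') / real n" for x y y' and n :: nat
    by (simp add: norm_divide flip: diff_divide_distrib)
  from k show ?thesis
    by (elim PlusE) (auto simp: diff intro!: entry fin P Q)
qed

lemma vnorm_steering: "vnorm A (steering q p) = sqrt (card A)"
  by (simp add: vnorm_def L2_set_def steering_eq_cis)

lemma vnorm_cnj_steering: "vnorm A (\<lambda>\<alpha>. cnj (steering q p \<alpha>)) = sqrt (card A)"
  unfolding vnorm_cnj by (rule vnorm_steering)

text \<open>The residual is the Euclidean norm of a pair whose entries each move by at most \<open>\<eta>\<close>, as
  steering vectors have squared norm \<open>card A\<close> and \<open>card B\<close>. The factor 2 bounds \<open>sqrt 2\<close>.\<close>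

lemma residual_close:
  assumes fin: "finite A" "A \<noteq> {}" "finite B" "B \<noteq> {}" and \<eta>: "0 \<le> \<eta>"
    and P: "\<And>v. vnorm A (\<lambda>i. mat_app A P v i - mat_app A P' v i) \<le> \<eta> * vnorm A v"
    and Q: "\<And>v. vnorm B (\<lambda>i. mat_app B Q v i - mat_app B Q' v i) \<le> \<eta> * vnorm B v"
  shows "residual A B q P Q p \<le> residual A B q P' Q' p + 2 * \<eta>"
proof -
  define x where "x = (\<lambda>P. vnorm A (\<lambda>\<alpha>. steering q p \<alpha> - mat_app A P (steering q p) \<alpha>) / sqrt (card A))"
  let ?w = "\<lambda>\<beta>. cnj (steering q p \<beta>)"
  define y where "y = (\<lambda>Q. vnorm B (\<lambda>\<beta>. ?w \<beta> - mat_app B Q ?w \<beta>) / sqrt (card B))"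
  have res: "residual A B q P Q p = sqrt ((x P)\<^sup>2 + (y Q)\<^sup>2)" for P Q
    by (simp add: residual_def Let_def x_def y_def power_divide)
  have close: "vnorm I (\<lambda>i. v i - mat_app I R v i) / sqrt (card I)
      \<le> vnorm I (\<lambda>i. v i - mat_app I R' v i) / sqrt (card I) + \<eta>"
    if I: "finite I" "I \<noteq> {}" and v: "vnorm I v = sqrt (card I)"
      and R: "vnorm I (\<lambda>i. mat_app I R v i - mat_app I R' v i) \<le> \<eta> * vnorm I v"
    for I :: "'x set" and R R' v
  proof -
    have n: "0 < sqrt (card I)" using I by (simp add: card_gt_0_iff)
    have "vnorm I (\<lambda>i. v i - mat_app I R v i)
        = vnorm I (\<lambda>i. (v i - mat_app I R' v i) - (mat_app I R v i - mat_app I R' v i))" by simp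
    also have "\<dots> \<le> vnorm I (\<lambda>i. v i - mat_app I R' v i) + \<eta> * sqrt (card I)"
      using vnorm_triangle_diff[of I "\<lambda>i. v i - mat_app I R' v i" "\<lambda>i. mat_app I R v i - mat_app I R' v i"]
        R unfolding v by linarith
    finally show ?thesis using n by (simp add: field_simps)
  qed
  have "x P \<le> x P' + \<eta>"
    unfolding x_def by (rule close[OF fin(1,2) vnorm_steering P])
  moreover have "y Q \<le> y Q' + \<eta>"
    unfolding y_def by (rule close[OF fin(3,4) vnorm_cnj_steering Q])
  moreover have "0 \<le> x P" "0 \<le> y Q" by (simp_all add: x_def y_def)
  ultimately have "residual A B q P Q p \<le> sqrt ((x P' + \<eta>)\<^sup>2 + (y Q' + \<eta>)\<^sup>2)"
    unfolding res by (intro real_sqrt_le_mono add_mono power_mono)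
  also have "\<dots> \<le> sqrt ((x P')\<^sup>2 + (y Q')\<^sup>2) + sqrt (\<eta>\<^sup>2 + \<eta>\<^sup>2)"
    by (rule real_sqrt_sum_squares_triangle_ineq)
  also have "sqrt (\<eta>\<^sup>2 + \<eta>\<^sup>2) \<le> 2 * \<eta>"
    using \<eta> by (intro real_le_lsqrt) (auto simp: power2_eq_square)
  finally show ?thesis by (simp add: res)
qed

lemma smallest_local_minima_sqrt:
  "smallest_local_minima (\<lambda>p. sqrt (f p)) F s M = smallest_local_minima f F s M"
  by (simp add: smallest_local_minima_def local_min_on_def)

section \<open>Perturbation of the residual\<close>

lemma vander_eq_steering: "vander q t \<alpha> j = steering q (t j) \<alpha>"
proof -
  have "node d x powi m = exp (- (\<i> * complex_of_real (of_int m * d * x)))" for d x m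
    by (simp add: node_def flip: exp_power_int) (simp add: exp_power_int algebra_simps)
  then show ?thesis
    by (simp add: vander_def steering_def algebra_simps flip: exp_add)
qed

lemma steering_add: "steering q p (\<alpha> + \<beta>) = steering q p \<alpha> * steering q p \<beta>"
  by (simp add: steering_def algebra_simps flip: exp_add)

lemma exp_sum_eq: "exp_sum q s t c k = (\<Sum>j<s. c j * vander q t k j)"
  by (simp add: exp_sum_def vander_def mult.assoc)

lemma lambda_min_lower_bound:
  assumes "1 \<le> s" "finite A" "full_column_rank A s X"
  shows "sqrt (lambda_min (gram A s X)) * vnorm {..<s} c \<le> vnorm A (mat_app {..<s} X c)"
proof -
  have "sqrt (lambda_min (gram A s X) * (vnorm {..<s} c)\<^sup>2) \<le> sqrt ((vnorm A (mat_app {..<s} X c))\<^sup>2)"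
    by (rule real_sqrt_le_mono[OF lambda_min_gram_le[OF assms]])
  then show ?thesis by (simp add: real_sqrt_mult)
qed

lemma cnj_lower_bound:
  assumes "\<And>c. b * vnorm {..<s} c \<le> vnorm B (mat_app {..<s} X c)"
  shows "b * vnorm {..<s} c \<le> vnorm B (mat_app {..<s} (\<lambda>i j. cnj (X i j)) c)"
proof -
  have "mat_app {..<s} (\<lambda>i j. cnj (X i j)) c = (\<lambda>i. cnj (mat_app {..<s} X (\<lambda>j. cnj (c j)) i))"
    by (simp add: mat_app_def fun_eq_iff)
  then show ?thesis
    using assms[of "\<lambda>j. cnj (c j)"] vnorm_cnj[of B "mat_app {..<s} X (\<lambda>j. cnj (c j))"]
      vnorm_cnj[of "{..<s}" c] by simp
qed

lemma is_svd_adj: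
  assumes "is_svd I J M U \<sigma> V"
  shows "is_svd J I (adj M) V \<sigma> U"
proof -
  have "adj M j i = (\<Sum>k<min (card J) (card I). V j k * complex_of_real (\<sigma> k) * cnj (U i k))"
    if "i \<in> I" "j \<in> J" for i j
  proof -
    have "M i j = (\<Sum>k<min (card I) (card J). U i k * complex_of_real (\<sigma> k) * cnj (V j k))"
      using assms that by (simp add: is_svd_def Let_def)
    then show ?thesis by (simp add: adj_def min.commute mult_ac)
  qed
  then show ?thesis
    using assms by (simp add: is_svd_def Let_def min.commute)
qed

text \<open>The smallest nonzero singular value of the exact Hankel matrix is at least
  \<open>g = sqrt (lambda_min A) sqrt (lambda_min B) min |c|\<close>. As \<open>card A / lambda_min A\<close> and its analogue
  for \<open>B\<close> are at most \<open>mu1\<close>, so is their geometric mean, and \<open>\<epsilon>\<close> dominates the spectral norm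
  of the perturbation divided by \<open>g\<close>. The right singular vectors are the left ones of the adjoint
  matrix, whose factorization has the two Vandermonde matrices exchanged.\<close>

lemma projectors_close:
  fixes c :: "nat \<Rightarrow> complex"
  assumes fin: "finite A" "A \<noteq> {}" "finite B" "B \<noteq> {}" and s: "1 \<le> s"
    and rank: "full_column_rank A s (vander q t)" "full_column_rank B s (vander q t)"
    and c: "\<forall>j<s. c j \<noteq> 0"
    and x: "\<forall>k\<in>sumset A B. x k = exp_sum q s t c k"
    and svd: "is_svd A B (hankel xh) U \<sigma> V"
    and \<epsilon>_def: "\<epsilon> = mu1 A B q s t * spectral_norm A B (hankel (\<lambda>k. xh k - x k))
      / (sqrt (real (card A) * real (card B)) * Min ((\<lambda>j. cmod (c j)) ` {..<s}))"
    and \<epsilon>: "\<epsilon> \<le> 1 / 2"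
    and P: "is_orth_projector A (column_space A s (vander q t)) P"
    and Q: "is_orth_projector B (column_space B s (\<lambda>\<beta> j. cnj (vander q t \<beta> j))) Q"
  shows "0 \<le> \<epsilon>"
    and "vnorm A (\<lambda>i. mat_app A P v i - mat_app A (leading_projector s U) v i) \<le> 4 * \<epsilon> * vnorm A v"
    and "vnorm B (\<lambda>i. mat_app B Q w i - mat_app B (leading_projector s V) w i) \<le> 4 * \<epsilon> * vnorm B w"
    and "orthonormal A {..<s} U" and "orthonormal B {..<s} V"
proof -
  let ?X = "vander q t" and ?Y = "\<lambda>\<beta> j. cnj (vander q t \<beta> j)"
  let ?E = "\<lambda>i j. hankel xh i j - hankel x i j"
  define e where "e = spectral_norm A B (hankel (\<lambda>k. xh k - x k))"
  define m where "m = Min ((\<lambda>j. cmod (c j)) ` {..<s})"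
  define la where "la = lambda_min (gram A s ?X)"
  define lb where "lb = lambda_min (gram B s ?X)"
  define g where "g = sqrt la * sqrt lb * m"
  have l: "0 < la" "0 < lb"
    unfolding la_def lb_def using lambda_min_gram_pos s fin rank by blast+
  have ne: "(\<lambda>j. cmod (c j)) ` {..<s} \<noteq> {}" using s by (simp add: lessThan_empty_iff)
  have m0: "0 < m" unfolding m_def using ne c by (subst Min_gr_iff) auto
  have ml: "m \<le> cmod (c k)" if "k < s" for k unfolding m_def using that by simp
  have g: "0 < g" using l m0 by (simp add: g_def)
  have e0: "0 \<le> e" unfolding e_def by (rule spectral_norm_nonneg[OF fin(1,3)])
  have E: "?E = hankel (\<lambda>k. xh k - x k)" by (simp add: hankel_def fun_eq_iff)
  have eb: "vnorm A (mat_app B ?E v) \<le> e * vnorm B v" for v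
    unfolding E e_def by (rule spectral_norm_bound[OF fin(1,3)])
  have card: "0 < real (card A)" "0 < real (card B)" using fin by (simp_all add: card_gt_0_iff)
  have mu: "sqrt (real (card A) / la * (real (card B) / lb)) \<le> mu1 A B q s t"
  proof (rule real_le_lsqrt)
    have "real (card A) / la * (real (card B) / lb) \<le> mu1 A B q s t * mu1 A B q s t"
      using l card by (intro mult_mono) (auto simp: mu1_def la_def lb_def le_max_iff_disj)
    then show "real (card A) / la * (real (card B) / lb) \<le> (mu1 A B q s t)\<^sup>2"
      by (simp add: power2_eq_square)
    have "0 \<le> real (card A) / la" using l by simp
    then show "0 \<le> mu1 A B q s t" unfolding mu1_def la_def by linarith
  qed
  have eg: "e / g \<le> \<epsilon>"
  proof -
    have "e / g = sqrt (real (card A) / la * (real (card B) / lb)) * (e / (sqrt (real (card A) * real (card B)) * m))"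
      using l card m0 by (simp add: g_def real_sqrt_mult real_sqrt_divide field_simps)
    also have "\<dots> \<le> mu1 A B q s t * (e / (sqrt (real (card A) * real (card B)) * m))"
      using mu e0 m0 card by (intro mult_right_mono) auto
    also have "\<dots> = \<epsilon>" by (simp add: \<epsilon>_def e_def m_def)
    finally show ?thesis .
  qed
  have "e / g \<le> 1 / 2" using eg \<epsilon> by linarith
  then have small: "2 * e \<le> g" using g by (simp add: field_simps)
  show "0 \<le> \<epsilon>" using eg e0 g by (meson divide_nonneg_pos order_trans)
  have H: "hankel x i j = (\<Sum>k<s. ?X i k * c k * cnj (?Y j k))" if "i \<in> A" "j \<in> B" for i j
  proof -
    have "i + j \<in> sumset A B" using that unfolding sumset_def by blast
    then have "hankel x i j = exp_sum q s t c (i + j)" using x by (simp add: hankel_def)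
    then show ?thesis by (simp add: exp_sum_eq vander_eq_steering steering_add mult_ac)
  qed
  interpret left: perturbed_factorization A B s ?X c ?Y "hankel x" "hankel xh" U \<sigma> V "sqrt la" "sqrt lb" m e
  proof
    show "sqrt la * vnorm {..<s} c \<le> vnorm A (mat_app {..<s} ?X c)" for c
      unfolding la_def by (rule lambda_min_lower_bound[OF s fin(1) rank(1)])
    show "sqrt lb * vnorm {..<s} c \<le> vnorm B (mat_app {..<s} ?Y c)" for c
      unfolding lb_def by (rule cnj_lower_bound[OF lambda_min_lower_bound[OF s fin(3) rank(2)]])
  qed (use fin s H ml l m0 svd eb e0 small in \<open>auto simp: g_def\<close>)
  interpret right: perturbed_factorization B A s ?Y "\<lambda>j. cnj (c j)" ?X "adj (hankel x)" "adj (hankel xh)"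
    V \<sigma> U "sqrt lb" "sqrt la" m e
  proof
    show "adj (hankel x) j i = (\<Sum>k<s. ?Y j k * cnj (c k) * cnj (?X i k))" if "j \<in> B" "i \<in> A" for i j
      using H[OF that(2,1)] by (simp add: adj_def mult_ac)
    show "vnorm B (mat_app A (\<lambda>i j. adj (hankel xh) i j - adj (hankel x) i j) v) \<le> e * vnorm A v" for v
    proof -
      have "(\<lambda>i j. adj (hankel xh) i j - adj (hankel x) i j) = adj ?E" by (simp add: adj_def fun_eq_iff)
      then show ?thesis using vnorm_adj_le[OF fin(1,3) eb e0, of v] by simp
    qed
    show "is_svd B A (adj (hankel xh)) V \<sigma> U" by (rule is_svd_adj[OF svd])
  qed (use fin s ml l m0 e0 small left.X_lower left.Y_lower in \<open>auto simp: g_def mult_ac\<close>)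
  have "4 * (e / g) \<le> 4 * \<epsilon>" using eg by simp
  then have eg4: "4 * e / (sqrt la * sqrt lb * m) \<le> 4 * \<epsilon>" by (simp add: g_def)
  show "vnorm A (\<lambda>i. mat_app A P v i - mat_app A (leading_projector s U) v i) \<le> 4 * \<epsilon> * vnorm A v"
    by (rule order_trans[OF left.projector_perturbation[OF P] mult_right_mono[OF eg4 vnorm_nonneg]])
  show "vnorm B (\<lambda>i. mat_app B Q w i - mat_app B (leading_projector s V) w i) \<le> 4 * \<epsilon> * vnorm B w"
    by (rule order_trans[OF right.projector_perturbation[OF Q]
          mult_right_mono[OF eg4[unfolded mult.commute[of "sqrt la"]] vnorm_nonneg]])
  show "orthonormal A {..<s} U" by (rule left.orthonormal_U_s)
  show "orthonormal B {..<s} V" by (rule right.orthonormal_U_s)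
qed

section \<open>Stability of the local minima of the residual\<close>

locale music_configuration =
  fixes A B :: "(int \<times> int) set" and q :: "real \<times> real" and s :: nat
    and t :: "nat \<Rightarrow> real \<times> real" and a b :: "real \<times> real" and \<Delta> :: real
  assumes fin: "finite A" "A \<noteq> {}" "finite B" "B \<noteq> {}"
    and q: "0 < fst q" "0 < snd q"
    and s: "1 \<le> s" and inj: "inj_on t {..<s}"
    and sides: "fst b - fst a < 2 * pi / fst q" "snd b - snd a < 2 * pi / snd q"
    and nodes: "t ` {..<s} \<subseteq> interior (cbox a b)"
    and rank: "full_column_rank A s (vander q t)" "full_column_rank B s (vander q t)"
    and \<Delta>: "0 < \<Delta>"
begin

abbreviation "F \<equiv> cbox a b"
abbreviation "T \<equiv> t ` {..<s}"
abbreviation "PA \<equiv> orth_projector A (column_space A s (vander q t))"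
abbreviation "PB \<equiv> orth_projector B (column_space B s (\<lambda>\<beta> j. cnj (vander q t \<beta> j)))"

lemma PA: "is_orth_projector A (column_space A s (vander q t)) PA"
  and PB: "is_orth_projector B (column_space B s (\<lambda>\<beta> j. cnj (vander q t \<beta> j))) PB"
  using is_orth_projector_orth_projector fin by blast+

lemma T_nonempty: "T \<noteq> {}" using s by (simp add: lessThan_empty_iff)

lemma card_T: "card T = s" using inj by (simp add: card_image)

text \<open>Below this radius, balls around the nodes are disjoint, the periodic distance is the
  Euclidean one, and the truncation in the growth condition is inactive.\<close>

lemma isolation_radius:
  obtains \<rho> where "0 < \<rho>" "\<rho> \<le> \<Delta> / 4"
    "\<And>p p'. p \<in> T \<Longrightarrow> p' \<in> T \<Longrightarrow> p \<noteq> p' \<Longrightarrow> 2 * \<rho> \<le> dist p p'"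
    "\<And>p p'. p \<in> F \<Longrightarrow> p' \<in> F \<Longrightarrow> d_per q p p' < \<rho> \<Longrightarrow> d_per q p p' = dist p p'"
proof -
  define D where "D = (\<lambda>(p, p'). dist p p') ` {(p, p'). p \<in> T \<and> p' \<in> T \<and> p \<noteq> p'}"
  have "finite {(p, p'). p \<in> T \<and> p' \<in> T \<and> p \<noteq> p'}"
    by (rule finite_subset[of _ "T \<times> T"]) auto
  then have D: "finite D" unfolding D_def by (rule finite_imageI)
  define gap where "gap = min (2 * pi / fst q - (fst b - fst a)) (2 * pi / snd q - (snd b - snd a))"
  define \<rho> where "\<rho> = min (min (\<Delta> / 4) gap) (Min (insert 1 D) / 2)"
  have "0 < Min (insert 1 D)" using D by (subst Min_gr_iff) (auto simp: D_def)
  then have "0 < \<rho>" using \<Delta> sides by (simp add: \<rho>_def gap_def)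
  moreover have "\<rho> \<le> \<Delta> / 4" by (simp add: \<rho>_def)
  moreover have "2 * \<rho> \<le> dist p p'" if "p \<in> T" "p' \<in> T" "p \<noteq> p'" for p p'
  proof -
    have "dist p p' \<in> D" using that by (force simp: D_def)
    then have "Min (insert 1 D) \<le> dist p p'" using D by simp
    then show ?thesis by (simp add: \<rho>_def)
  qed
  moreover have "d_per q p p' = dist p p'" if "p \<in> F" "p' \<in> F" "d_per q p p' < \<rho>" for p p'
  proof (rule d_per_eq_dist[OF q _ sides(1) _ sides(2) _ _ that(3)])
    have "p \<in> cbox (fst a, snd a) (fst b, snd b)" "p' \<in> cbox (fst a, snd a) (fst b, snd b)"
      using that by simp_all
    then have "fst p \<in> {fst a..fst b}" "snd p \<in> {snd a..snd b}" "fst p' \<in> {fst a..fst b}" "snd p' \<in> {snd a..snd b}"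
      unfolding cbox_Pair_eq by auto
    then show "\<bar>fst p - fst p'\<bar> \<le> fst b - fst a" "\<bar>snd p - snd p'\<bar> \<le> snd b - snd a" by auto
  qed (simp_all add: \<rho>_def gap_def)
  ultimately show thesis by (rule that)
qed

lemma nodes_in_F: "t ` {..<s} \<subseteq> F"
  using nodes interior_subset by blast

lemma exact_residual_at_node:
  assumes "p \<in> T"
  shows "exact_residual A B q s t p = 0"
proof -
  obtain j where j: "j < s" "p = t j" using assms by auto
  have col: "steering q p \<alpha> = mat_app {..<s} (vander q t) (\<lambda>k. of_bool (k = j)) \<alpha>" for \<alpha>
  proof -
    have "mat_app {..<s} (vander q t) (\<lambda>k. of_bool (k = j)) \<alpha> = (\<Sum>k<s. if k = j then vander q t \<alpha> j else 0)"
      unfolding mat_app_def by (intro sum.cong) auto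
    then show ?thesis using j by (simp add: vander_eq_steering)
  qed
  have v: "steering q p \<in> column_space A s (vander q t)"
    unfolding column_space_def using col by blast
  have "cnj (steering q p \<beta>) = mat_app {..<s} (\<lambda>\<beta> j. cnj (vander q t \<beta> j)) (\<lambda>k. of_bool (k = j)) \<beta>" for \<beta>
    unfolding col by (simp add: mat_app_def)
  then have w: "(\<lambda>\<beta>. cnj (steering q p \<beta>)) \<in> column_space B s (\<lambda>\<beta> j. cnj (vander q t \<beta> j))"
    unfolding column_space_def by blast
  have "vnorm A (\<lambda>\<alpha>. steering q p \<alpha> - mat_app A PA (steering q p) \<alpha>) = 0"
    using projector_fixes[OF PA v fin(1)] fin by (simp add: vnorm_zero_iff)
  moreover have "vnorm B (\<lambda>\<beta>. cnj (steering q p \<beta>) - mat_app B PB (\<lambda>\<beta>. cnj (steering q p \<beta>)) \<beta>) = 0"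
    using projector_fixes[OF PB w fin(3)] fin by (simp add: vnorm_zero_iff)
  ultimately show ?thesis by (simp add: exact_residual_def residual_def Let_def)
qed

lemma residual_nonneg: "0 \<le> residual A B q P Q p"
  by (simp add: residual_def Let_def)

lemma d_per_set_near:
  assumes \<rho>: "\<And>p p'. p \<in> T \<Longrightarrow> p' \<in> T \<Longrightarrow> p \<noteq> p' \<Longrightarrow> 2 * \<rho> \<le> dist p p'"
    "\<And>p p'. p \<in> F \<Longrightarrow> p' \<in> F \<Longrightarrow> d_per q p p' < \<rho> \<Longrightarrow> d_per q p p' = dist p p'"
    and p: "p \<in> F" "p0 \<in> T" "dist p p0 < \<rho>"
  shows "d_per_set q p T = dist p p0" "d_per q p p0 = dist p p0"
proof -
  have lt: "d_per q p p0 < \<rho>" using d_per_le_dist[of q p p0] p(3) by simp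
  show eq: "d_per q p p0 = dist p p0" by (rule \<rho>(2)[OF p(1) _ lt]) (use p nodes_in_F in blast)
  have "d_per_set q p T \<in> d_per q p ` T"
    unfolding d_per_set_def using T_nonempty by (intro Min_in) auto
  then obtain p1 where p1: "p1 \<in> T" "d_per_set q p T = d_per q p p1" by auto
  have "d_per q p p1 \<le> d_per q p p0"
    unfolding p1(2)[symmetric] d_per_set_def using p(2) by (intro Min_le) auto
  then have lt1: "d_per q p p1 < \<rho>" using lt by simp
  have "d_per q p p1 = dist p p1" by (rule \<rho>(2)[OF p(1) _ lt1]) (use p1 nodes_in_F in blast)
  then have "dist p p1 < \<rho>" using lt1 by simp
  then have "p1 = p0" using \<rho>(1)[OF p1(1) p(2)] dist_triangle[of p1 p0 p] p(3) by (force simp: dist_commute)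
  then show "d_per_set q p T = dist p p0" using p1 eq by simp
qed

text \<open>The constant \<open>cM'\<close> is any constant for which growth holds: it only fixes, through the
  curvature of the squared residual at the nodes, the admissible size of the perturbation. The
  estimate itself uses the given \<open>cM\<close>.\<close>

lemma minima_near_nodes:
  assumes "0 < cM'" and growth: "residual_growth A B q s t F \<Delta> cM'"
  obtains c0 where "0 < c0"
    "\<And>cM c x xh U \<sigma> V. 0 < cM \<Longrightarrow> cM \<le> c0 \<Longrightarrow> residual_growth A B q s t F \<Delta> cM \<Longrightarrow>
      \<forall>j<s. c j \<noteq> 0 \<Longrightarrow> \<forall>k\<in>sumset A B. x k = exp_sum q s t c k \<Longrightarrow>
      is_svd A B (hankel xh) U \<sigma> V \<Longrightarrow>
      error_scale A B q s t c cM (\<lambda>k. xh k - x k) \<le> \<Delta> \<Longrightarrow>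
      \<exists>th. inj_on th T \<and>
        (\<forall>p\<in>T. d_per q (th p) p \<le> 16 * error_scale A B q s t c cM (\<lambda>k. xh k - x k)) \<and>
        (\<forall>M. smallest_local_minima (svd_residual A B q s U V) F s M \<longleftrightarrow> M = th ` T)"
proof -
  let ?K = "residual_index A B" and ?w = "residual_freq q"
  let ?a = "residual_coeff A B PA PB"
  let ?f = "trig ?K ?w ?a"
  obtain \<rho> where \<rho>: "0 < \<rho>" "\<rho> \<le> \<Delta> / 4"
    "\<And>p p'. p \<in> T \<Longrightarrow> p' \<in> T \<Longrightarrow> p \<noteq> p' \<Longrightarrow> 2 * \<rho> \<le> dist p p'"
    "\<And>p p'. p \<in> F \<Longrightarrow> p' \<in> F \<Longrightarrow> d_per q p p' < \<rho> \<Longrightarrow> d_per q p p' = dist p p'"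
    using isolation_radius by blast
  have R: "exact_residual A B q s t p = sqrt (?f p)" for p
    unfolding exact_residual_def by (rule residual_eq_sqrt_trig[OF fin(1,3) PA PB])
  have f: "?f p = (exact_residual A B q s t p)\<^sup>2" if "0 \<le> exact_residual A B q s t p" for p
    using that unfolding R by simp
  have R0: "0 \<le> exact_residual A B q s t p" for p
    unfolding exact_residual_def by (rule residual_nonneg)
  obtain \<delta> where \<delta>: "0 < \<delta>" "\<forall>a'. (\<forall>k\<in>?K. cmod (a' k - ?a k) \<le> \<delta>) \<longrightarrow>
    (\<exists>th. inj_on th T \<and>
      (\<forall>p\<in>T. th p \<in> F \<and> dist (th p) p < \<rho> \<and> trig ?K ?w a' (th p) \<le> trig ?K ?w a' p) \<and>
      (\<forall>M. smallest_local_minima (trig ?K ?w a') F (card T) M \<longleftrightarrow> M = th ` T))"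
  proof -
    have "\<exists>\<delta>>0. \<forall>a'. (\<forall>k\<in>?K. cmod (a' k - ?a k) \<le> \<delta>) \<longrightarrow>
    (\<exists>th. inj_on th T \<and>
      (\<forall>p\<in>T. th p \<in> F \<and> dist (th p) p < \<rho> \<and> trig ?K ?w a' (th p) \<le> trig ?K ?w a' p) \<and>
      (\<forall>M. smallest_local_minima (trig ?K ?w a') F (card T) M \<longleftrightarrow> M = th ` T))"
    proof (rule trig_minima_stable)
      show "finite ?K" using fin by simp
      show "0 < cM'\<^sup>2" using assms(1) by simp
      show "?f p = 0" if "p \<in> T" for p
        using f[OF R0, of p] exact_residual_at_node[OF that] by simp
      show "0 < ?f p" if p: "p \<in> F" "p \<notin> T" for p
      proof -
        have "0 < d_per_set q p T"
          unfolding d_per_set_def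
        proof (subst Min_gr_iff)
          show "\<forall>d\<in>d_per q p ` T. 0 < d"
          proof
            fix d assume "d \<in> d_per q p ` T"
            then obtain p1 where p1: "p1 \<in> T" "d = d_per q p p1" by auto
            show "0 < d"
            proof (rule ccontr)
              assume "\<not> 0 < d"
              then have "d_per q p p1 = dist p p1"
                using p1 p(1) \<rho>(1) nodes_in_F by (intro \<rho>(4)) auto
              then have "p = p1" using \<open>\<not> 0 < d\<close> p1 by simp
              then show False using p1 p by simp
            qed
          qed
        qed (use T_nonempty in auto)
        then have "0 < cM' * min (\<Delta> / 4) (d_per_set q p T)" using assms(1) \<Delta> by simp
        then have "0 < exact_residual A B q s t p"
          using growth p(1) unfolding residual_growth_def by fastforce
        then show ?thesis using f[OF R0, of p] by simp
      qed
      show "cM'\<^sup>2 * (dist p p0)\<^sup>2 \<le> ?f p" if p: "p0 \<in> T" "p \<in> F" "dist p p0 < \<rho>" for p0 p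
      proof -
        have "d_per_set q p T = dist p p0" by (rule d_per_set_near(1)[OF \<rho>(3,4) p(2,1,3)])
        then have "cM' * dist p p0 \<le> exact_residual A B q s t p"
          using growth p(2,3) \<rho>(2) unfolding residual_growth_def by (fastforce simp: min_def)
        then have "(cM' * dist p p0)\<^sup>2 \<le> (exact_residual A B q s t p)\<^sup>2"
          using assms(1) by (intro power_mono) auto
        then show ?thesis using f[OF R0, of p] by (simp add: power_mult_distrib)
      qed
    qed (use nodes \<rho> in auto)
    then show thesis using that by blast
  qed
  \<comment> \<open>With \<open>\<epsilon> \<le> cM \<Delta>\<close>, the first bound gives \<open>4 \<epsilon> \<le> \<delta>\<close> for the stability of the minima,
    the second \<open>\<epsilon> \<le> 1 / 2\<close> for the perturbation of the projectors.\<close>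
  define c0 where "c0 = min (\<delta> / (4 * \<Delta>)) (1 / (2 * \<Delta>))"
  have "0 < c0" using \<delta>(1) \<Delta> by (simp add: c0_def)
  moreover have "\<exists>th. inj_on th T \<and>
        (\<forall>p\<in>T. d_per q (th p) p \<le> 16 * error_scale A B q s t c cM (\<lambda>k. xh k - x k)) \<and>
        (\<forall>M. smallest_local_minima (svd_residual A B q s U V) F s M \<longleftrightarrow> M = th ` T)"
    if cM: "0 < cM" "cM \<le> c0" and growth: "residual_growth A B q s t F \<Delta> cM"
      and c: "\<forall>j<s. c j \<noteq> 0" and x: "\<forall>k\<in>sumset A B. x k = exp_sum q s t c k"
      and svd: "is_svd A B (hankel xh) U \<sigma> V"
      and small: "error_scale A B q s t c cM (\<lambda>k. xh k - x k) \<le> \<Delta>"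
    for cM c x xh U \<sigma> V
  proof -
    let ?err = "error_scale A B q s t c cM (\<lambda>k. xh k - x k)"
    define \<epsilon> where "\<epsilon> = mu1 A B q s t * spectral_norm A B (hankel (\<lambda>k. xh k - x k))
      / (sqrt (real (card A) * real (card B)) * Min ((\<lambda>j. cmod (c j)) ` {..<s}))"
    have \<epsilon>: "\<epsilon> = cM * ?err" using cM by (simp add: \<epsilon>_def error_scale_def)
    have "cM * ?err \<le> c0 * \<Delta>"
    proof (cases "0 \<le> ?err")
      case True
      then show ?thesis using cM small \<Delta> by (intro mult_mono) auto
    next
      case False
      then have "cM * ?err \<le> 0" using cM by (intro mult_nonneg_nonpos) auto
      moreover have "0 \<le> c0 * \<Delta>" using cM \<Delta> by simp
      ultimately show ?thesis by linarith
    qed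
    then have "\<epsilon> \<le> c0 * \<Delta>" by (simp add: \<epsilon> mult_ac)
    moreover have "c0 \<le> \<delta> / (4 * \<Delta>)" "c0 \<le> 1 / (2 * \<Delta>)" by (simp_all add: c0_def)
    then have "c0 * (4 * \<Delta>) \<le> \<delta>" "c0 * (2 * \<Delta>) \<le> 1"
      using \<Delta> by (simp_all add: pos_le_divide_eq)
    ultimately have \<epsilon>_small: "4 * \<epsilon> \<le> \<delta>" "\<epsilon> \<le> 1 / 2" by linarith+
    let ?PU = "leading_projector s U" and ?PV = "leading_projector s V"
    note close = projectors_close[OF fin s rank c x svd \<epsilon>_def \<epsilon>_small(2) PA PB]
    have PU: "is_orth_projector A (column_space A s U) ?PU" and PV: "is_orth_projector B (column_space B s V) ?PV"
      using leading_projector_is_orth_projector close(4,5) by blast+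
    let ?a' = "residual_coeff A B ?PU ?PV"
    have Rh: "svd_residual A B q s U V = (\<lambda>p. sqrt (trig ?K ?w ?a' p))"
      unfolding svd_residual_def using residual_eq_sqrt_trig[OF fin(1,3) PU PV] by (rule ext)
    have "cmod (?a' k - ?a k) \<le> \<delta>" if "k \<in> ?K" for k
      using residual_coeff_close[OF fin(1,3) close(2,3) that] \<epsilon>_small(1) by simp
    then have "\<forall>k\<in>?K. cmod (?a' k - ?a k) \<le> \<delta>" by blast
    from \<delta>(2)[THEN spec, THEN mp, OF this] obtain th where th': "inj_on th T \<and>
      (\<forall>p\<in>T. th p \<in> F \<and> dist (th p) p < \<rho> \<and> trig ?K ?w ?a' (th p) \<le> trig ?K ?w ?a' p) \<and>
      (\<forall>M. smallest_local_minima (trig ?K ?w ?a') F (card T) M \<longleftrightarrow> M = th ` T)" ..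
    note th = th'[THEN conjunct1] th'[THEN conjunct2, THEN conjunct1, rule_format]
      th'[THEN conjunct2, THEN conjunct2, rule_format]
    have RRh: "exact_residual A B q s t p \<le> svd_residual A B q s U V p + 2 * (4 * \<epsilon>)"
      and RhR: "svd_residual A B q s U V p \<le> exact_residual A B q s t p + 2 * (4 * \<epsilon>)" for p
    proof -
      have swap: "vnorm I (\<lambda>i. mat_app I P v i - mat_app I Q v i) = vnorm I (\<lambda>i. mat_app I Q v i - mat_app I P v i)"
        for I :: "'x set" and P Q v by (simp add: vnorm_def norm_minus_commute)
      show "exact_residual A B q s t p \<le> svd_residual A B q s U V p + 2 * (4 * \<epsilon>)"
        unfolding exact_residual_def svd_residual_def
        by (rule residual_close[OF fin _ close(2,3)]) (use close(1) in simp)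
      show "svd_residual A B q s U V p \<le> exact_residual A B q s t p + 2 * (4 * \<epsilon>)"
        unfolding exact_residual_def svd_residual_def
        by (rule residual_close[OF fin _ close(2,3)[unfolded swap[of _ PA] swap[of _ PB]]]) (use close(1) in simp)
    qed
    have "d_per q (th p) p \<le> 16 * ?err" if p: "p \<in> T" for p
    proof -
      note thp = th(2)[OF p]
      let ?d = "d_per q (th p) p"
      have d: "?d = d_per_set q (th p) T" "?d < \<rho>"
        using d_per_set_near[OF \<rho>(3,4) _ p, of "th p"] thp by auto
      have "svd_residual A B q s U V (th p) \<le> svd_residual A B q s U V p"
        unfolding Rh using thp by simp
      also have "\<dots> \<le> 8 * \<epsilon>" using RhR[of p] exact_residual_at_node[OF p] by simp
      finally have "exact_residual A B q s t (th p) \<le> 16 * \<epsilon>" using RRh[of "th p"] by simp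
      moreover have "cM * min (\<Delta> / 4) ?d \<le> exact_residual A B q s t (th p)"
        using growth thp unfolding residual_growth_def d(1) by blast
      moreover have "min (\<Delta> / 4) ?d = ?d" using d(2) \<rho>(2) by simp
      ultimately have "cM * ?d \<le> cM * (16 * ?err)" by (simp add: \<epsilon>)
      then show ?thesis using cM by simp
    qed
    moreover have "smallest_local_minima (svd_residual A B q s U V) F s M \<longleftrightarrow> M = th ` T" for M
      using th(3)[of M] unfolding Rh smallest_local_minima_sqrt card_T .
    ultimately show ?thesis using th(1) by blast
  qed
  ultimately show thesis by (rule that)
qed

end

theorem theorem4p7:
  shows "\<exists>C4 C5 :: real. C4 > 0 \<and> C5 > 0 \<and>
    (\<forall>(A :: (int \<times> int) set) (B :: (int \<times> int) set) (q :: real \<times> real) (s :: nat)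
       (t :: nat \<Rightarrow> real \<times> real) (a :: real \<times> real) (b :: real \<times> real) (F :: (real \<times> real) set)
       (\<Delta> :: real).
      finite A \<and> A \<noteq> {} \<and> finite B \<and> B \<noteq> {} \<and>
      fst q > 0 \<and> snd q > 0 \<and>
      s \<ge> 1 \<and> inj_on t {..<s} \<and>
      F = cbox a b \<and> fst b - fst a < 2 * pi / fst q \<and> snd b - snd a < 2 * pi / snd q \<and>
      t ` {..<s} \<subseteq> interior F \<and>
      full_column_rank A s (vander q t) \<and> full_column_rank B s (vander q t) \<and>
      \<Delta> > 0 \<and> separated q \<Delta> (t ` {..<s}) \<and>
      (\<exists>cM>0. residual_growth A B q s t F \<Delta> cM) \<longrightarrow>
      (\<exists>c0>0. \<forall>cM. 0 < cM \<and> cM \<le> c0 \<and> residual_growth A B q s t F \<Delta> cM \<longrightarrow>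
        (\<forall>(c :: nat \<Rightarrow> complex) (x :: int \<times> int \<Rightarrow> complex) (xh :: int \<times> int \<Rightarrow> complex) U \<sigma> V.
          (\<forall>j<s. c j \<noteq> 0) \<and>
          (\<forall>k\<in>sumset A B. x k = exp_sum q s t c k) \<and>
          is_svd A B (hankel xh) U \<sigma> V \<and>
          \<Delta> \<ge> C4 * error_scale A B q s t c cM (\<lambda>k. xh k - x k) \<longrightarrow>
          (\<exists>M. smallest_local_minima (svd_residual A B q s U V) F s M) \<and>
          (\<forall>M. smallest_local_minima (svd_residual A B q s U V) F s M \<longrightarrow>
            (\<exists>th. bij_betw th {..<s} M \<and>
              Max ((\<lambda>j. d_per q (th j) (t j)) ` {..<s})
                \<le> C5 * error_scale A B q s t c cM (\<lambda>k. xh k - x k))))))"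
proof (rule exI[of _ 1], rule exI[of _ 16], intro conjI allI impI; (elim conjE exE)?)
  fix A B :: "(int \<times> int) set" and q :: "real \<times> real" and s and t :: "nat \<Rightarrow> real \<times> real"
    and a b :: "real \<times> real" and F and \<Delta> cM' :: real
  assume fin: "finite A" "A \<noteq> {}" "finite B" "B \<noteq> {}" and q: "0 < fst q" "0 < snd q"
    and s: "1 \<le> s" and inj: "inj_on t {..<s}" and F: "F = cbox a b"
    and sides: "fst b - fst a < 2 * pi / fst q" "snd b - snd a < 2 * pi / snd q"
    and nodes: "t ` {..<s} \<subseteq> interior F"
    and rank: "full_column_rank A s (vander q t)" "full_column_rank B s (vander q t)"
    and \<Delta>: "0 < \<Delta>" and cM': "0 < cM'" "residual_growth A B q s t F \<Delta> cM'"
  interpret music_configuration A B q s t a b \<Delta>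
    by unfold_locales (fact fin q s inj sides nodes[unfolded F] rank \<Delta>)+
  obtain c0 where c0: "0 < c0" and
    main: "\<And>cM c x xh U \<sigma> V. 0 < cM \<Longrightarrow> cM \<le> c0 \<Longrightarrow> residual_growth A B q s t F \<Delta> cM \<Longrightarrow>
      \<forall>j<s. c j \<noteq> 0 \<Longrightarrow> \<forall>k\<in>sumset A B. x k = exp_sum q s t c k \<Longrightarrow>
      is_svd A B (hankel xh) U \<sigma> V \<Longrightarrow>
      error_scale A B q s t c cM (\<lambda>k. xh k - x k) \<le> \<Delta> \<Longrightarrow>
      \<exists>th. inj_on th (t ` {..<s}) \<and>
        (\<forall>p\<in>t ` {..<s}. d_per q (th p) p \<le> 16 * error_scale A B q s t c cM (\<lambda>k. xh k - x k)) \<and>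
        (\<forall>M. smallest_local_minima (svd_residual A B q s U V) F s M \<longleftrightarrow> M = th ` t ` {..<s})"
    using minima_near_nodes[OF cM'(1) cM'(2)[unfolded F]] unfolding F by blast
  show "\<exists>c0>0. \<forall>cM. 0 < cM \<and> cM \<le> c0 \<and> residual_growth A B q s t F \<Delta> cM \<longrightarrow>
        (\<forall>(c :: nat \<Rightarrow> complex) (x :: int \<times> int \<Rightarrow> complex) (xh :: int \<times> int \<Rightarrow> complex) U \<sigma> V.
          (\<forall>j<s. c j \<noteq> 0) \<and>
          (\<forall>k\<in>sumset A B. x k = exp_sum q s t c k) \<and>
          is_svd A B (hankel xh) U \<sigma> V \<and>
          \<Delta> \<ge> 1 * error_scale A B q s t c cM (\<lambda>k. xh k - x k) \<longrightarrow>
          (\<exists>M. smallest_local_minima (svd_residual A B q s U V) F s M) \<and>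
          (\<forall>M. smallest_local_minima (svd_residual A B q s U V) F s M \<longrightarrow>
            (\<exists>th. bij_betw th {..<s} M \<and>
              Max ((\<lambda>j. d_per q (th j) (t j)) ` {..<s})
                \<le> 16 * error_scale A B q s t c cM (\<lambda>k. xh k - x k))))"
  proof (intro exI[of _ c0] conjI[OF c0] allI impI, elim conjE)
    fix cM and c :: "nat \<Rightarrow> complex" and x xh :: "int \<times> int \<Rightarrow> complex" and U \<sigma> V
    let ?err = "error_scale A B q s t c cM (\<lambda>k. xh k - x k)"
    assume hyps: "0 < cM" "cM \<le> c0" "residual_growth A B q s t F \<Delta> cM" "\<forall>j<s. c j \<noteq> 0"
      "\<forall>k\<in>sumset A B. x k = exp_sum q s t c k" "is_svd A B (hankel xh) U \<sigma> V" and "1 * ?err \<le> \<Delta>"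
    then have "?err \<le> \<Delta>" by simp
    from main[OF hyps this] obtain th' where th': "inj_on th' (t ` {..<s}) \<and>
        (\<forall>p\<in>t ` {..<s}. d_per q (th' p) p \<le> 16 * ?err) \<and>
        (\<forall>M. smallest_local_minima (svd_residual A B q s U V) F s M \<longleftrightarrow> M = th' ` t ` {..<s})" ..
    note th = th'[THEN conjunct1] th'[THEN conjunct2, THEN conjunct1, rule_format]
      th'[THEN conjunct2, THEN conjunct2, rule_format]
    have bij: "bij_betw (th' \<circ> t) {..<s} (th' ` t ` {..<s})"
      using inj th(1) by (simp add: bij_betw_def comp_inj_on image_comp)
    have "Max ((\<lambda>j. d_per q ((th' \<circ> t) j) (t j)) ` {..<s}) \<le> 16 * ?err"
      using s th(2) by (subst Max_le_iff) (auto simp: lessThan_empty_iff)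
    with bij have "\<exists>th. bij_betw th {..<s} (th' ` t ` {..<s}) \<and>
        Max ((\<lambda>j. d_per q (th j) (t j)) ` {..<s}) \<le> 16 * ?err"
      by (intro exI[of _ "th' \<circ> t"] conjI)
    then show "(\<exists>M. smallest_local_minima (svd_residual A B q s U V) F s M) \<and>
          (\<forall>M. smallest_local_minima (svd_residual A B q s U V) F s M \<longrightarrow>
            (\<exists>th. bij_betw th {..<s} M \<and>
              Max ((\<lambda>j. d_per q (th j) (t j)) ` {..<s}) \<le> 16 * ?err))"
      unfolding th(3) by simp
  qed
qed simp_all

end
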